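(* Let $\Psi=\{\psi_n\}_{n\ge0}$ be an increasing sequence of finite Blaschke products on $\mathbb{D}$ and $\Phi=\{\varphi_n\}_{n\ge0}$ a decreasing sequence of Blaschke products on $\mathbb{D}$, and let $\mathcal{Q}_{\Psi,\Phi}$ be the corresponding Rudin quotient module of $H^2(\mathbb{D}^2)$. Then $\mathcal{Q}_{\Psi,\Phi}$ is not essentially normal.
   Context: $H^2(\mathbb{D})$ and $H^2(\mathbb{D}^2)=H^2(\mathbb{D})\otimes H^2(\mathbb{D})$ are the Hardy spaces over the unit disc and bidisc. For an inner function $\theta$ on $\mathbb{D}$, $\mathcal{Q}_\theta=H^2(\mathbb{D})\ominus\theta H^2(\mathbb{D})$. "Increasing" for $\Psi$ means that $\psi_{n+1}/\psi_n$ is a non-constant inner function for all $n\ge0$; "decreasing" for $\Phi$ means that $\varphi_n/\varphi_{n+1}$ is a non-constant inner function for all $n\ge0$. The Rudin quotient module is $\mathcal{Q}_{\Psi,\Phi}=\bigvee_{n=0}^\infty(\mathcal{Q}_{\psi_n}\otimes\mathcal{Q}_{\varphi_n})$ (closed linear span in $H^2(\mathbb{D}^2)$). A quotient module of $H^2(\mathbb{D}^2)$ is a closed subspace $\mathcal{Q}$ such that $\mathcal{Q}^\perp$ is invariant under the coordinate multiplication operators $M_{z_1},M_{z_2}$; put $C_{z_i}=P_{\mathcal{Q}}M_{z_i}|_{\mathcal{Q}}$. $\mathcal{Q}$ is essentially normal if $[C_{z_i},C_{z_j}^*]$ is compact for all $i,j\in\{1,2\}$. *)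

theory Defs
  imports "HOL-Complex_Analysis.Complex_Analysis"
begin

section \<open>Functions on the unit disc\<close>

text \<open>Only the values on \<^term>\<open>ball 0 1 :: complex set\<close> of the functions in this section matter.\<close>

definition inner_function :: "(complex \<Rightarrow> complex) \<Rightarrow> bool" where
  "inner_function \<theta> \<longleftrightarrow>
     \<theta> holomorphic_on ball 0 1 \<and> bounded (\<theta> ` ball 0 1) \<and>
     (AE t in lborel. \<exists>L. cmod L = 1 \<and>
        ((\<lambda>r. \<theta> (complex_of_real r * cis t)) \<longlongrightarrow> L) (at_left 1))"

text \<open>The quotient \<open>f / g\<close> is understood after removal of its removable singularities, whence
  the existential quantifier and the restriction to points where \<open>g\<close> does not vanish.\<close>

definition nonconstant_inner_quotient :: "(complex \<Rightarrow> complex) \<Rightarrow> (complex \<Rightarrow> complex) \<Rightarrow> bool" where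
  "nonconstant_inner_quotient f g \<longleftrightarrow>
     (\<exists>\<theta>. inner_function \<theta> \<and> \<not> \<theta> constant_on ball 0 1 \<and>
          (\<forall>z\<in>ball 0 1. g z \<noteq> 0 \<longrightarrow> \<theta> z = f z / g z))"

definition increasing_inner :: "(nat \<Rightarrow> complex \<Rightarrow> complex) \<Rightarrow> bool" where
  "increasing_inner \<psi> \<longleftrightarrow> (\<forall>n. nonconstant_inner_quotient (\<psi> (Suc n)) (\<psi> n))"

definition decreasing_inner :: "(nat \<Rightarrow> complex \<Rightarrow> complex) \<Rightarrow> bool" where
  "decreasing_inner \<phi> \<longleftrightarrow> (\<forall>n. nonconstant_inner_quotient (\<phi> n) (\<phi> (Suc n)))"

definition blaschke_factor :: "complex \<Rightarrow> complex \<Rightarrow> complex" where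
  "blaschke_factor a z =
     (if a = 0 then z else (complex_of_real (cmod a) / a) * ((a - z) / (1 - cnj a * z)))"

text \<open>A unimodular constant factor is allowed; in the finite case the list of zeros may be empty.\<close>

definition finite_blaschke_product :: "(complex \<Rightarrow> complex) \<Rightarrow> bool" where
  "finite_blaschke_product f \<longleftrightarrow>
     (\<exists>c as. cmod c = 1 \<and> set as \<subseteq> ball 0 1 \<and>
        (\<forall>z\<in>ball 0 1. f z = c * (\<Prod>a\<leftarrow>as. blaschke_factor a z)))"

definition infinite_blaschke_product :: "(complex \<Rightarrow> complex) \<Rightarrow> bool" where
  "infinite_blaschke_product f \<longleftrightarrow>
     (\<exists>c (a :: nat \<Rightarrow> complex). cmod c = 1 \<and> range a \<subseteq> ball 0 1 \<and>
        summable (\<lambda>n. 1 - cmod (a n)) \<and>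
        (\<forall>z\<in>ball 0 1. f z = c * (\<Prod>n. blaschke_factor (a n) z)))"

definition blaschke_product :: "(complex \<Rightarrow> complex) \<Rightarrow> bool" where
  "blaschke_product f \<longleftrightarrow> finite_blaschke_product f \<or> infinite_blaschke_product f"


section \<open>The Hardy space of the disc\<close>

definition taylor_coeff :: "(complex \<Rightarrow> complex) \<Rightarrow> nat \<Rightarrow> complex" where
  "taylor_coeff f n = (deriv ^^ n) f 0 / fact n"

definition hardy_disc :: "(complex \<Rightarrow> complex) set" where
  "hardy_disc = {f. f holomorphic_on ball 0 1 \<and> summable (\<lambda>n. (cmod (taylor_coeff f n))\<^sup>2)}"

definition hardy_disc_inner :: "(complex \<Rightarrow> complex) \<Rightarrow> (complex \<Rightarrow> complex) \<Rightarrow> complex" where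
  "hardy_disc_inner f g = (\<Sum>n. taylor_coeff f n * cnj (taylor_coeff g n))"

text \<open>The model space \<open>H\<^sup>2 \<ominus> \<theta> H\<^sup>2\<close>.\<close>

definition model_space :: "(complex \<Rightarrow> complex) \<Rightarrow> (complex \<Rightarrow> complex) set" where
  "model_space \<theta> =
     {f \<in> hardy_disc. \<forall>g\<in>hardy_disc. hardy_disc_inner f (\<lambda>z. \<theta> z * g z) = 0}"


section \<open>The Hardy space of the bidisc\<close>

definition bidisc :: "(complex \<times> complex) set" where
  "bidisc = ball 0 1 \<times> ball 0 1"

definition hardy_series :: "(nat \<times> nat \<Rightarrow> complex) \<Rightarrow> (complex \<times> complex \<Rightarrow> complex) \<Rightarrow> bool" where
  "hardy_series a f \<longleftrightarrow>
     (\<lambda>k. (cmod (a k))\<^sup>2) summable_on UNIV \<and>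
     (\<forall>z\<in>bidisc. ((\<lambda>k. a k * (fst z ^ fst k * snd z ^ snd k)) has_sum f z) UNIV)"

text \<open>Elements are functions on the bidisc with square-summable Taylor coefficients; they are
  extended by \<open>0\<close> outside the bidisc, so that equality in the type is equality on the bidisc.\<close>

typedef hardy2 = "{f. (\<exists>a. hardy_series a f) \<and> (\<forall>z. z \<notin> bidisc \<longrightarrow> f z = 0)}"
  morphisms hardy2_fun Abs_hardy2
proof
  show "(\<lambda>_. 0) \<in> {f. (\<exists>a. hardy_series a f) \<and> (\<forall>z. z \<notin> bidisc \<longrightarrow> f z = 0)}"
    by (auto simp: hardy_series_def intro!: exI[of _ "\<lambda>_. 0"])
qed

setup_lifting type_definition_hardy2

definition hardy2_coeff :: "hardy2 \<Rightarrow> nat \<times> nat \<Rightarrow> complex" where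
  "hardy2_coeff F = (THE a. hardy_series a (hardy2_fun F))"

definition cinner :: "hardy2 \<Rightarrow> hardy2 \<Rightarrow> complex" where
  "cinner F G = (\<Sum>\<^sub>\<infinity>k. hardy2_coeff F k * cnj (hardy2_coeff G k))"

lemma summable_on_cmod2_add:
  fixes a b :: "'i \<Rightarrow> complex"
  assumes "(\<lambda>k. (cmod (a k))\<^sup>2) summable_on A" "(\<lambda>k. (cmod (b k))\<^sup>2) summable_on A"
  shows "(\<lambda>k. (cmod (a k + b k))\<^sup>2) summable_on A"
proof (rule summable_on_comparison_test)
  show "(\<lambda>k. 2 * (cmod (a k))\<^sup>2 + 2 * (cmod (b k))\<^sup>2) summable_on A"
    by (intro summable_on_add summable_on_cmult_right assms)
  show "(cmod (a k + b k))\<^sup>2 \<le> 2 * (cmod (a k))\<^sup>2 + 2 * (cmod (b k))\<^sup>2" for k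
  proof -
    have "(cmod (a k + b k))\<^sup>2 \<le> (cmod (a k) + cmod (b k))\<^sup>2"
      by (intro power_mono norm_triangle_ineq) auto
    also have "\<dots> \<le> 2 * (cmod (a k))\<^sup>2 + 2 * (cmod (b k))\<^sup>2"
      using zero_le_power2[of "cmod (a k) - cmod (b k)"]
      by (simp add: power2_sum power2_diff)
    finally show ?thesis .
  qed
qed auto

lemma summable_on_cmod2_mult:
  fixes a b :: "'i \<Rightarrow> complex"
  assumes "(\<lambda>k. (cmod (a k))\<^sup>2) summable_on A" "(\<lambda>k. (cmod (b k))\<^sup>2) summable_on A"
  shows "(\<lambda>k. a k * cnj (b k)) summable_on A"
proof -
  have "(\<lambda>k. norm (a k * cnj (b k))) summable_on A"
  proof (rule summable_on_comparison_test)
    show "(\<lambda>k. (cmod (a k))\<^sup>2 + (cmod (b k))\<^sup>2) summable_on A"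
      by (intro summable_on_add assms)
    show "norm (a k * cnj (b k)) \<le> (cmod (a k))\<^sup>2 + (cmod (b k))\<^sup>2" for k
    proof -
      have "2 * (cmod (a k) * cmod (b k)) \<le> (cmod (a k))\<^sup>2 + (cmod (b k))\<^sup>2"
        using zero_le_power2[of "cmod (a k) - cmod (b k)"] by (simp add: power2_diff)
      moreover have "0 \<le> cmod (a k) * cmod (b k)" by simp
      ultimately show ?thesis unfolding norm_mult complex_mod_cnj by linarith
    qed
  qed auto
  then show ?thesis by (rule abs_summable_summable)
qed

lemma hardy_series_add:
  assumes "hardy_series a f" "hardy_series b g"
  shows "hardy_series (\<lambda>k. a k + b k) (\<lambda>z. f z + g z)"
  using assms unfolding hardy_series_def
  by (auto simp: distrib_right intro!: has_sum_add summable_on_cmod2_add)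

lemma hardy_series_scale:
  assumes "hardy_series a f"
  shows "hardy_series (\<lambda>k. c * a k) (\<lambda>z. c * f z)"
  using assms unfolding hardy_series_def
  by (auto simp: norm_mult power_mult_distrib mult.assoc
      intro!: has_sum_cmult_right summable_on_cmult_right)

lemma powser_unique_0:
  fixes c :: "nat \<Rightarrow> complex"
  assumes "\<And>z. cmod z < 1 \<Longrightarrow> (\<lambda>n. c n * z ^ n) sums 0"
  shows "c n = 0"
proof (rule ccontr)
  assume n: "c n \<noteq> 0"
  define m where "m = (LEAST n. c n \<noteq> 0)"
  have m: "c m \<noteq> 0" unfolding m_def by (rule LeastI, rule n)
  have lt: "c k = 0" if "k < m" for k
    using not_less_Least that unfolding m_def by blast
  have sm: "(\<lambda>k. c (k + m) * z ^ k) sums 0" if "cmod z < 1" "z \<noteq> 0" for z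
  proof -
    have "(\<lambda>k. c (k + m) * z ^ (k + m)) sums 0"
      using sums_iff_shift[of "\<lambda>n. c n * z ^ n" m 0] assms[OF that(1)] lt by simp
    then have "(\<lambda>k. c (k + m) * z ^ (k + m) / z ^ m) sums (0 / z ^ m)"
      by (rule sums_divide)
    then show ?thesis using that by (simp add: power_add)
  qed
  define h where "h = (\<lambda>z. \<Sum>k. c (k + m) * z ^ k)"
  have s2: "summable (\<lambda>k. c (k + m) * (1/2::complex) ^ k)"
    using sm[of "1/2"] by (auto simp: sums_iff norm_divide)
  have "isCont h 0"
    unfolding h_def by (rule isCont_powser[OF s2]) simp
  then have "(h \<longlongrightarrow> h 0) (at 0)" by (simp add: isCont_def)
  moreover have "(h \<longlongrightarrow> 0) (at 0)"
  proof (rule tendsto_eventually)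
    show "eventually (\<lambda>z. h z = 0) (at 0)"
      unfolding eventually_at by (rule exI[of _ 1]) (auto simp: h_def dest!: sm sums_unique)
  qed
  ultimately have "h 0 = 0" using tendsto_unique by (metis trivial_limit_at)
  then show False using m by (simp add: h_def)
qed

lemma hardy_series_zero:
  assumes "hardy_series d f" "\<And>z. z \<in> bidisc \<Longrightarrow> f z = 0"
  shows "d = (\<lambda>_. 0)"
proof -
  have hs: "((\<lambda>(m, n). d (m, n) * (z ^ m * w ^ n)) has_sum 0) (UNIV \<times> UNIV)"
    if "cmod z < 1" "cmod w < 1" for z w
    using assms that by (auto simp: hardy_series_def bidisc_def case_prod_unfold)
  have row: "(\<lambda>n. d (m, n) * w ^ n) summable_on UNIV" if w: "cmod w < 1" for m w
  proof -
    have "(\<lambda>n. d (m, n) * ((1/2) ^ m * w ^ n)) summable_on UNIV"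
      using summable_on_SigmaD1[OF has_sum_imp_summable[OF hs[of "1/2" w]], of m] w
      by (simp add: norm_divide)
    then have "(\<lambda>n. d (m, n) * ((1/2) ^ m * w ^ n) * 2 ^ m) summable_on UNIV"
      by (rule summable_on_cmult_left)
    then show ?thesis by (simp add: field_simps)
  qed
  have row0: "(\<Sum>\<^sub>\<infinity>n. d (m, n) * w ^ n) = 0" if w: "cmod w < 1" for m w
  proof (rule powser_unique_0)
    fix z :: complex assume z: "cmod z < 1"
    have "((\<lambda>m. (\<Sum>\<^sub>\<infinity>n. d (m, n) * w ^ n) * z ^ m) has_sum 0) UNIV"
    proof (rule has_sum_SigmaD[OF hs[OF z w]])
      fix m
      show "((\<lambda>n. case (m, n) of (m, n) \<Rightarrow> d (m, n) * (z ^ m * w ^ n))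
              has_sum (\<Sum>\<^sub>\<infinity>n. d (m, n) * w ^ n) * z ^ m) UNIV"
        using has_sum_cmult_left[OF has_sum_infsum[OF row[OF w, of m]], of "z ^ m"]
        by (simp add: mult_ac)
    qed
    then show "(\<lambda>m. (\<Sum>\<^sub>\<infinity>n. d (m, n) * w ^ n) * z ^ m) sums 0"
      by (rule has_sum_imp_sums)
  qed
  have "d (m, n) = 0" for m n
  proof (rule powser_unique_0)
    fix w :: complex assume w: "cmod w < 1"
    show "(\<lambda>n. d (m, n) * w ^ n) sums 0"
      using has_sum_imp_sums[OF has_sum_infsum[OF row[OF w, of m]]] row0[OF w] by simp
  qed
  then show ?thesis by (auto simp: fun_eq_iff)
qed

lemma hardy_series_unique:
  assumes "hardy_series a f" "hardy_series b f"
  shows "a = b"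
proof -
  have "hardy_series (\<lambda>k. a k + (- 1) * b k) (\<lambda>z. f z + (- 1) * f z)"
    by (intro hardy_series_add hardy_series_scale assms)
  from hardy_series_zero[OF this] show ?thesis by (simp add: fun_eq_iff)
qed

lemma hardy2_coeff_eqI: "hardy_series a (hardy2_fun F) \<Longrightarrow> hardy2_coeff F = a"
  unfolding hardy2_coeff_def by (blast intro: the_equality hardy_series_unique)

lemma hardy_series_coeff: "hardy_series (hardy2_coeff F) (hardy2_fun F)"
  using hardy2_fun[of F] hardy2_coeff_eqI by auto

lemma hardy2_coeff_square_summable: "(\<lambda>k. (cmod (hardy2_coeff F k))\<^sup>2) summable_on UNIV"
  using hardy_series_coeff unfolding hardy_series_def by blast

instantiation hardy2 :: real_vector
begin

lift_definition zero_hardy2 :: hardy2 is "\<lambda>_. 0"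
  by (auto simp: hardy_series_def intro!: exI[of _ "\<lambda>_. 0"])

lift_definition plus_hardy2 :: "hardy2 \<Rightarrow> hardy2 \<Rightarrow> hardy2" is "\<lambda>f g z. f z + g z"
  by (auto intro: hardy_series_add)

lift_definition uminus_hardy2 :: "hardy2 \<Rightarrow> hardy2" is "\<lambda>f z. - f z"
  using hardy_series_scale[of _ _ "- 1"] by fastforce

lift_definition minus_hardy2 :: "hardy2 \<Rightarrow> hardy2 \<Rightarrow> hardy2" is "\<lambda>f g z. f z - g z"
  using hardy_series_add[OF _ hardy_series_scale[of _ _ "- 1"]] by fastforce

lift_definition scaleR_hardy2 :: "real \<Rightarrow> hardy2 \<Rightarrow> hardy2" is "\<lambda>r f z. complex_of_real r * f z"
  by (auto intro: hardy_series_scale)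

instance
  by standard (transfer; auto simp: fun_eq_iff algebra_simps)+

end

lift_definition scaleC :: "complex \<Rightarrow> hardy2 \<Rightarrow> hardy2" is "\<lambda>c f z. c * f z"
  by (auto intro: hardy_series_scale)

global_interpretation hardy2: vector_space scaleC
  defines hardy2_span = hardy2.span
  by standard (transfer; auto simp: fun_eq_iff algebra_simps)+

lemma hardy2_coeff_zero: "hardy2_coeff 0 = (\<lambda>_. 0)"
  by (rule hardy2_coeff_eqI) (simp add: hardy_series_def zero_hardy2.rep_eq)

lemma hardy2_coeff_add: "hardy2_coeff (F + G) = (\<lambda>k. hardy2_coeff F k + hardy2_coeff G k)"
  by (rule hardy2_coeff_eqI)
    (use hardy_series_add[OF hardy_series_coeff hardy_series_coeff] in \<open>simp add: plus_hardy2.rep_eq\<close>)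

lemma hardy2_coeff_scaleC: "hardy2_coeff (scaleC c F) = (\<lambda>k. c * hardy2_coeff F k)"
  by (rule hardy2_coeff_eqI)
    (use hardy_series_scale[OF hardy_series_coeff] in \<open>simp add: scaleC.rep_eq\<close>)

lemma scaleR_hardy2_eq: "r *\<^sub>R (F :: hardy2) = scaleC (complex_of_real r) F"
  by transfer simp

lemma hardy2_coeff_eq_zero: "hardy2_coeff F = (\<lambda>_. 0) \<Longrightarrow> F = 0"
proof -
  assume "hardy2_coeff F = (\<lambda>_. 0)"
  then have "hardy_series (\<lambda>_. 0) (hardy2_fun F)" using hardy_series_coeff[of F] by simp
  then have "hardy2_fun F z = 0" if "z \<in> bidisc" for z
  proof -
    have "((\<lambda>_ :: nat \<times> nat. 0) has_sum hardy2_fun F z) UNIV"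
      using \<open>hardy_series (\<lambda>_. 0) (hardy2_fun F)\<close> that by (simp add: hardy_series_def)
    then show ?thesis by (rule has_sum_unique) simp
  qed
  moreover have "hardy2_fun F z = 0" if "z \<notin> bidisc" for z
    using hardy2_fun[of F] that by blast
  ultimately have "hardy2_fun F z = 0" for z by blast
  then show ?thesis by (simp add: hardy2_fun_inject[symmetric] zero_hardy2.rep_eq fun_eq_iff)
qed

lemma cinner_summable: "(\<lambda>k. hardy2_coeff F k * cnj (hardy2_coeff G k)) summable_on UNIV"
  by (intro summable_on_cmod2_mult hardy2_coeff_square_summable)

lemma cinner_commute: "cinner F G = cnj (cinner G F)"
  unfolding cinner_def by (simp add: infsum_cnj[symmetric] mult.commute del: infsum_cnj)

lemma cinner_add_left: "cinner (F + G) H = cinner F H + cinner G H"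
  unfolding cinner_def
  by (simp add: hardy2_coeff_add distrib_right infsum_add[OF cinner_summable cinner_summable])

lemma cinner_scaleC_left: "cinner (scaleC c F) G = c * cinner F G"
  unfolding cinner_def by (simp add: hardy2_coeff_scaleC mult.assoc infsum_cmult_right')

lemma cinner_self: "cinner F F = complex_of_real (\<Sum>\<^sub>\<infinity>k. (cmod (hardy2_coeff F k))\<^sup>2)"
  unfolding cinner_def
proof (rule infsumI)
  have "((\<lambda>k. complex_of_real ((cmod (hardy2_coeff F k))\<^sup>2)) has_sum
      complex_of_real (\<Sum>\<^sub>\<infinity>k. (cmod (hardy2_coeff F k))\<^sup>2)) UNIV"
    by (intro has_sum_of_real has_sum_infsum hardy2_coeff_square_summable)
  then show "((\<lambda>k. hardy2_coeff F k * cnj (hardy2_coeff F k)) has_sum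
      complex_of_real (\<Sum>\<^sub>\<infinity>k. (cmod (hardy2_coeff F k))\<^sup>2)) UNIV"
    by (simp only: complex_norm_square)
qed

text \<open>The real inner product \<^term>\<open>Re (cinner F G)\<close> induces the Hardy space norm
  \<open>sqrt (\<Sum>k. (cmod (hardy2_coeff F k))\<^sup>2)\<close> and hence its topology.\<close>

instantiation hardy2 :: real_inner
begin

definition inner_hardy2 :: "hardy2 \<Rightarrow> hardy2 \<Rightarrow> real" where
  "inner_hardy2 F G = Re (cinner F G)"

definition norm_hardy2 :: "hardy2 \<Rightarrow> real" where
  "norm_hardy2 F = sqrt (inner F F)"

definition dist_hardy2 :: "hardy2 \<Rightarrow> hardy2 \<Rightarrow> real" where
  "dist_hardy2 F G = norm (F - G)"

definition sgn_hardy2 :: "hardy2 \<Rightarrow> hardy2" where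
  "sgn_hardy2 F = inverse (norm F) *\<^sub>R F"

definition uniformity_hardy2 :: "(hardy2 \<times> hardy2) filter" where
  "uniformity_hardy2 = (INF e\<in>{0<..}. principal {(F, G). dist F G < e})"

definition open_hardy2 :: "hardy2 set \<Rightarrow> bool" where
  "open_hardy2 U \<longleftrightarrow> (\<forall>F\<in>U. eventually (\<lambda>(F', G). F' = F \<longrightarrow> G \<in> U) uniformity)"

instance
proof
  fix F G H :: hardy2 and r :: real and U :: "hardy2 set"
  show "dist F G = norm (F - G)" by (rule dist_hardy2_def)
  show "sgn F = F /\<^sub>R norm F" by (simp add: sgn_hardy2_def)
  show "uniformity = (INF e\<in>{0<..}. principal {(F, G :: hardy2). dist F G < e})"
    by (rule uniformity_hardy2_def)
  show "open U = (\<forall>F\<in>U. \<forall>\<^sub>F (F', G) in uniformity. F' = F \<longrightarrow> G \<in> U)"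
    by (rule open_hardy2_def)
  show "inner F G = inner G F"
    unfolding inner_hardy2_def by (subst cinner_commute) simp
  show "inner (F + G) H = inner F H + inner G H"
    by (simp add: inner_hardy2_def cinner_add_left)
  show "inner (r *\<^sub>R F) G = r * inner F G"
    by (simp add: inner_hardy2_def scaleR_hardy2_eq cinner_scaleC_left)
  show "0 \<le> inner F F"
    by (simp add: inner_hardy2_def cinner_self infsum_nonneg)
  show "norm F = sqrt (inner F F)" by (rule norm_hardy2_def)
  show "inner F F = 0 \<longleftrightarrow> F = 0"
  proof
    assume "inner F F = 0"
    then have *: "(\<Sum>\<^sub>\<infinity>k. (cmod (hardy2_coeff F k))\<^sup>2) = 0"
      by (simp add: inner_hardy2_def cinner_self)
    have "(cmod (hardy2_coeff F k))\<^sup>2 = 0" for k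
      by (rule nonneg_infsum_le_0D[of "\<lambda>k. (cmod (hardy2_coeff F k))\<^sup>2" UNIV])
        (use * hardy2_coeff_square_summable in auto)
    then show "F = 0" by (intro hardy2_coeff_eq_zero) auto
  next
    assume "F = 0"
    then show "inner F F = 0" by (simp add: inner_hardy2_def cinner_def hardy2_coeff_zero)
  qed
qed

end


section \<open>Operators on closed subspaces and essential normality\<close>

definition hardy2_proj :: "hardy2 set \<Rightarrow> hardy2 \<Rightarrow> hardy2" where
  "hardy2_proj Q F = (THE G. G \<in> Q \<and> (\<forall>H\<in>Q. cinner (F - G) H = 0))"

text \<open>The Hilbert space adjoint of an operator \<open>T\<close> from \<open>Q\<close> to \<open>Q\<close>.\<close>

definition adjoint_on :: "hardy2 set \<Rightarrow> (hardy2 \<Rightarrow> hardy2) \<Rightarrow> hardy2 \<Rightarrow> hardy2" where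
  "adjoint_on Q T F = (THE G. G \<in> Q \<and> (\<forall>H\<in>Q. cinner (T H) F = cinner H G))"

definition compact_operator_on :: "hardy2 set \<Rightarrow> (hardy2 \<Rightarrow> hardy2) \<Rightarrow> bool" where
  "compact_operator_on Q T \<longleftrightarrow> compact (closure (T ` (Q \<inter> cball 0 1)))"

text \<open>Multiplication by \<open>p\<close>; the coordinate multiplications \<open>M\<^bsub>z1\<^esub>\<close>, \<open>M\<^bsub>z2\<^esub>\<close> are obtained
  for \<open>p = fst\<close> and \<open>p = snd\<close>.\<close>

definition mult_op :: "(complex \<times> complex \<Rightarrow> complex) \<Rightarrow> hardy2 \<Rightarrow> hardy2" where
  "mult_op p F = Abs_hardy2 (\<lambda>z. p z * hardy2_fun F z)"

lemma hardy_series_shift: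
  fixes s :: "nat \<times> nat \<Rightarrow> nat \<times> nat"
  assumes a: "hardy_series a f" and s: "inj s"
    and p: "\<And>z k. p z * (fst z ^ fst k * snd z ^ snd k) = fst z ^ fst (s k) * snd z ^ snd (s k)"
  shows "hardy_series (\<lambda>k. if k \<in> range s then a (inv s k) else 0) (\<lambda>z. p z * f z)"
    (is "hardy_series ?b _")
  unfolding hardy_series_def
proof (intro conjI ballI)
  have b: "?b (s k) = a k" for k
    using s by simp
  have "(\<lambda>k. (cmod (?b k))\<^sup>2) summable_on range s"
    using a s by (subst summable_on_reindex) (auto simp: o_def hardy_series_def)
  then show "(\<lambda>k. (cmod (?b k))\<^sup>2) summable_on UNIV"
    by (rule summable_on_cong_neutral[THEN iffD1, rotated -1]) auto
  fix z :: "complex \<times> complex" assume "z \<in> bidisc"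
  then have "((\<lambda>k. p z * (a k * (fst z ^ fst k * snd z ^ snd k))) has_sum p z * f z) UNIV"
    using a by (intro has_sum_cmult_right) (auto simp: hardy_series_def)
  also have "(\<lambda>k. p z * (a k * (fst z ^ fst k * snd z ^ snd k)))
      = (\<lambda>k. ?b k * (fst z ^ fst k * snd z ^ snd k)) \<circ> s"
    unfolding o_def b by (simp add: p[symmetric] mult_ac)
  finally have "((\<lambda>k. ?b k * (fst z ^ fst k * snd z ^ snd k)) has_sum p z * f z) (range s)"
    by (simp only: has_sum_reindex[OF s])
  then show "((\<lambda>k. ?b k * (fst z ^ fst k * snd z ^ snd k)) has_sum p z * f z) UNIV"
    by (rule has_sum_cong_neutral[THEN iffD1, rotated -1]) auto
qed

lemma hardy2_fun_mult_op:
  assumes "p \<in> {fst, snd}"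
  shows "hardy2_fun (mult_op p F) = (\<lambda>z. p z * hardy2_fun F z)"
proof -
  have "\<exists>a. hardy_series a (\<lambda>z. p z * hardy2_fun F z)"
    using assms
  proof (elim insertE emptyE)
    assume p: "p = fst"
    show ?thesis
      unfolding p by (rule exI, rule hardy_series_shift[OF hardy_series_coeff, where s = "\<lambda>(m, n). (Suc m, n)"])
        (auto simp: inj_on_def)
  next
    assume p: "p = snd"
    show ?thesis
      unfolding p by (rule exI, rule hardy_series_shift[OF hardy_series_coeff, where s = "\<lambda>(m, n). (m, Suc n)"])
        (auto simp: inj_on_def)
  qed
  then show ?thesis
    unfolding mult_op_def using hardy2_fun[of F] by (subst Abs_hardy2_inverse) auto
qed

definition compression :: "hardy2 set \<Rightarrow> (complex \<times> complex \<Rightarrow> complex) \<Rightarrow> hardy2 \<Rightarrow> hardy2" where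
  "compression Q p F = hardy2_proj Q (mult_op p F)"

definition essentially_normal :: "hardy2 set \<Rightarrow> bool" where
  "essentially_normal Q \<longleftrightarrow>
     (\<forall>p\<in>{fst, snd}. \<forall>q\<in>{fst, snd}.
        compact_operator_on Q
          (\<lambda>F. compression Q p (adjoint_on Q (compression Q q) F)
             - adjoint_on Q (compression Q q) (compression Q p F)))"


section \<open>Rudin quotient modules\<close>

text \<open>The Hilbert space tensor product \<open>A \<otimes> B\<close> inside the Hardy space of the bidisc, where
  \<open>(f \<otimes> g) (z, w) = f z * g w\<close>.\<close>

definition hardy_tensor ::
    "(complex \<Rightarrow> complex) set \<Rightarrow> (complex \<Rightarrow> complex) set \<Rightarrow> hardy2 set" where
  "hardy_tensor A B = closure (hardy2_span
     {F. \<exists>f\<in>A. \<exists>g\<in>B. \<forall>z\<in>ball 0 1. \<forall>w\<in>ball 0 1. hardy2_fun F (z, w) = f z * g w})"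

definition rudin_quotient_module ::
    "(nat \<Rightarrow> complex \<Rightarrow> complex) \<Rightarrow> (nat \<Rightarrow> complex \<Rightarrow> complex) \<Rightarrow> hardy2 set" where
  "rudin_quotient_module \<psi> \<phi> =
     closure (hardy2_span (\<Union>n. hardy_tensor (model_space (\<psi> n)) (model_space (\<phi> n))))"

end

theory Submission
  imports Defs
begin

text \<open>
  The self-commutator \<open>T = [C, C\<^sup>*]\<close> of \<open>C = C\<^bsub>z1\<^esub>\<close> is not compact. Let \<open>\<psi> = \<psi>\<^sub>1\<close>,
  \<open>e = 1 - cnj (\<psi> 0) \<psi>\<close> and \<open>s = 1 - \<bar>\<psi> 0\<bar>\<^sup>2 = e 0 = \<parallel>e\<parallel>\<^sup>2\<close>, and pick mutually orthogonal \<open>f\<^sub>n\<close>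
  in the model spaces of \<open>\<phi>\<^sub>n\<close>; they exist because these spaces decrease strictly. For
  \<open>x = e \<otimes> f\<^sub>n\<close> with \<open>\<parallel>x\<parallel> = 1\<close> one has \<open>\<langle>T x, x\<rangle> = \<parallel>C\<^sup>* x\<parallel>\<^sup>2 - \<parallel>C x\<parallel>\<^sup>2\<close>. Since \<open>C\<^sup>*\<close> is the
  backward shift, \<open>\<parallel>C\<^sup>* x\<parallel>\<^sup>2 = 1 - s\<close>. On the other hand \<open>1 - \<parallel>C x\<parallel>\<^sup>2\<close> is the squared distance of \<open>z\<^sub>1 x\<close> from
  the module, which is at most \<open>\<bar>\<langle>z e, \<psi>\<^sub>n\<rangle>\<bar>\<^sup>2 / s\<close>; writing \<open>\<psi>\<^sub>n = \<psi> g\<close>, the inner product equals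
  \<open>cnj (\<psi>' 0 * g 0)\<close> and is at most \<open>s \<gamma>\<close> in modulus by Schwarz--Pick, where
  \<open>\<gamma> = \<bar>(\<psi>\<^sub>2 / \<psi>\<^sub>1) 0\<bar> < 1\<close>. Hence \<open>\<langle>T x, x\<rangle> \<le> - s (1 - \<gamma>\<^sup>2)\<close> along an orthonormal sequence.

  Of the Blaschke products only the isometry of multiplication on \<open>H\<^sup>2\<close> is used; the ratios
  inherit it.
\<close>

section \<open>The Hardy space of the disc\<close>

abbreviation disc :: "complex set" where "disc \<equiv> ball 0 1"

section \<open>Taylor coefficients on the unit disc\<close>

lemma taylor_coeff_sums:
  assumes "f holomorphic_on disc" "z \<in> disc"
  shows "(\<lambda>n. taylor_coeff f n * z ^ n) sums f z"
  using holomorphic_power_series[OF assms] by (simp add: taylor_coeff_def)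

text \<open>The expansion itself makes \<open>f\<close> holomorphic, so \<open>f\<close> has a
  Taylor series with the same sum, and \<open>powser_unique_0\<close> applies to the difference.
  Most coefficient formulas below are read off an explicit expansion in this way.\<close>

lemma taylor_coeff_eqI:
  assumes "\<And>z. z \<in> disc \<Longrightarrow> (\<lambda>n. a n * z ^ n) sums f z"
  shows "taylor_coeff f = a"
proof
  fix n
  have "f holomorphic_on disc"
    by (rule power_series_holomorphic[of 0 1 a]) (use assms in auto)
  then have "(\<lambda>n. (taylor_coeff f n - a n) * z ^ n) sums 0" if "cmod z < 1" for z
    using sums_diff[OF taylor_coeff_sums assms, of f z z] that by (simp add: left_diff_distrib)
  then show "taylor_coeff f n = a n"
    using powser_unique_0[of "\<lambda>n. taylor_coeff f n - a n" n] by simp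
qed

lemma taylor_coeff_cong:
  assumes "\<And>z. z \<in> disc \<Longrightarrow> f z = g z"
  shows "taylor_coeff f = taylor_coeff g"
proof
  fix n
  have "eventually (\<lambda>z. z \<in> disc) (nhds (0::complex))"
    by (intro eventually_nhds_in_open) auto
  then have "eventually (\<lambda>z. f z = g z) (nhds 0)"
    by eventually_elim (use assms in auto)
  then show "taylor_coeff f n = taylor_coeff g n"
    unfolding taylor_coeff_def by (subst higher_deriv_cong_ev) auto
qed

lemma taylor_coeff_0 [simp]: "taylor_coeff f 0 = f 0"
  by (simp add: taylor_coeff_def)

lemma taylor_coeff_const: "taylor_coeff (\<lambda>_. c) = (\<lambda>n. if n = 0 then c else 0)"
proof (rule taylor_coeff_eqI)
  fix z :: complex
  have "(\<lambda>n. (if n = 0 then c else 0) * z ^ n) = (\<lambda>n. if n = 0 then c else 0)" by auto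
  then show "(\<lambda>n. (if n = 0 then c else 0) * z ^ n) sums c"
    using sums_single[of 0 "\<lambda>_. c"] by simp
qed

lemma taylor_coeff_add:
  assumes "f holomorphic_on disc" "g holomorphic_on disc"
  shows "taylor_coeff (\<lambda>z. f z + g z) = (\<lambda>n. taylor_coeff f n + taylor_coeff g n)"
  by (rule taylor_coeff_eqI) (use assms in \<open>auto simp: distrib_right intro!: sums_add taylor_coeff_sums\<close>)

lemma taylor_coeff_cmult:
  assumes "f holomorphic_on disc"
  shows "taylor_coeff (\<lambda>z. c * f z) = (\<lambda>n. c * taylor_coeff f n)"
  by (rule taylor_coeff_eqI) (use assms in \<open>auto simp: mult.assoc intro!: sums_mult taylor_coeff_sums\<close>)

text \<open>This is the Leibniz rule for higher derivatives; the binomial coefficient turns the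
  factorial of \<open>n\<close> into the two factorials that normalise the factors.\<close>

lemma taylor_coeff_mult:
  assumes "f holomorphic_on disc" "g holomorphic_on disc"
  shows "taylor_coeff (\<lambda>z. f z * g z) n = (\<Sum>i\<le>n. taylor_coeff f i * taylor_coeff g (n - i))"
proof -
  have *: "of_nat (n choose i) * x * y / fact n = x / fact i * (y / fact (n - i))"
    if "i \<le> n" for i and x y :: complex
    using that by (simp add: binomial_fact field_simps)
  show ?thesis
    unfolding taylor_coeff_def higher_deriv_mult[OF assms open_ball centre_in_ball[THEN iffD2, OF zero_less_one]]
      sum_divide_distrib atLeast0AtMost
    by (rule sum.cong) (use * in auto)
qed

lemma taylor_coeff_shift:
  assumes "f holomorphic_on disc"
  shows "taylor_coeff (\<lambda>z. z * f z) = (\<lambda>n. if n = 0 then 0 else taylor_coeff f (n - 1))"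
proof (rule taylor_coeff_eqI)
  fix z :: complex assume "z \<in> disc"
  from sums_mult[OF taylor_coeff_sums[OF assms this], of z]
  show "(\<lambda>n. (if n = 0 then 0 else taylor_coeff f (n - 1)) * z ^ n) sums (z * f z)"
    by (subst sums_Suc_iff[symmetric, where f="\<lambda>n. (if n = 0 then 0 else taylor_coeff f (n - 1)) * z ^ n" and s="z * f z", simplified])
      (simp add: mult_ac)
qed

text \<open>Away from 0 this is \<open>(f z - f 0) / z\<close>. The series form also covers the
  origin and shows the coefficients directly.\<close>

definition backward_shift :: "(complex \<Rightarrow> complex) \<Rightarrow> complex \<Rightarrow> complex" where
  "backward_shift f z = (\<Sum>n. taylor_coeff f (Suc n) * z ^ n)"

lemma backward_shift_sums:
  assumes "f holomorphic_on disc" "z \<in> disc"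
  shows "(\<lambda>n. taylor_coeff f (Suc n) * z ^ n) sums backward_shift f z"
proof -
  have "summable (\<lambda>n. taylor_coeff f (Suc n) * z ^ n)"
    using taylor_coeff_sums[OF assms] by (subst summable_powser_split_head) (auto simp: sums_iff)
  then show ?thesis
    unfolding backward_shift_def by (rule summable_sums)
qed

lemma taylor_coeff_backward_shift:
  assumes "f holomorphic_on disc"
  shows "taylor_coeff (backward_shift f) = (\<lambda>n. taylor_coeff f (Suc n))"
  by (rule taylor_coeff_eqI) (rule backward_shift_sums[OF assms])

lemma holomorphic_backward_shift:
  assumes "f holomorphic_on disc"
  shows "backward_shift f holomorphic_on disc"
  by (rule power_series_holomorphic[of 0 1 "\<lambda>n. taylor_coeff f (Suc n)"])
    (use backward_shift_sums[OF assms] in auto)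

lemma backward_shift_decomp:
  assumes "f holomorphic_on disc" "z \<in> disc"
  shows "f z = f 0 + z * backward_shift f z"
proof -
  have "(\<lambda>n. taylor_coeff f n * z ^ n) sums (z * backward_shift f z + taylor_coeff f 0 * z ^ 0)"
    using sums_mult[OF backward_shift_sums[OF assms], of z]
    by (subst sums_Suc_iff[symmetric]) (simp add: mult_ac)
  from sums_unique2[OF this taylor_coeff_sums[OF assms]] show ?thesis by (simp add: add.commute)
qed

section \<open>Membership and inner product in H^2\<close>

lemma hardy_disc_holomorphic: "f \<in> hardy_disc \<Longrightarrow> f holomorphic_on disc"
  by (simp add: hardy_disc_def)

lemma hardy_disc_summable: "f \<in> hardy_disc \<Longrightarrow> summable (\<lambda>n. (cmod (taylor_coeff f n))\<^sup>2)"
  by (simp add: hardy_disc_def)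

lemma hardy_disc_const: "(\<lambda>_. c) \<in> hardy_disc"
  by (auto simp: hardy_disc_def taylor_coeff_const intro!: summable_finite[of "{0}"] split: if_splits)

lemma hardy_disc_add:
  assumes "f \<in> hardy_disc" "g \<in> hardy_disc"
  shows "(\<lambda>z. f z + g z) \<in> hardy_disc"
proof -
  have "summable (\<lambda>n. (cmod (taylor_coeff f n + taylor_coeff g n))\<^sup>2)"
  proof (rule summable_comparison_test')
    show "summable (\<lambda>n. 2 * (cmod (taylor_coeff f n))\<^sup>2 + 2 * (cmod (taylor_coeff g n))\<^sup>2)"
      using assms by (intro summable_add summable_mult hardy_disc_summable)
    fix n
    have "(cmod (taylor_coeff f n + taylor_coeff g n))\<^sup>2 \<le> (cmod (taylor_coeff f n) + cmod (taylor_coeff g n))\<^sup>2"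
      by (intro power_mono norm_triangle_ineq) auto
    also have "\<dots> \<le> 2 * (cmod (taylor_coeff f n))\<^sup>2 + 2 * (cmod (taylor_coeff g n))\<^sup>2"
      using zero_le_power2[of "cmod (taylor_coeff f n) - cmod (taylor_coeff g n)"]
      by (simp add: power2_sum power2_diff)
    finally show "norm ((cmod (taylor_coeff f n + taylor_coeff g n))\<^sup>2)
        \<le> 2 * (cmod (taylor_coeff f n))\<^sup>2 + 2 * (cmod (taylor_coeff g n))\<^sup>2" by simp
  qed
  with assms show ?thesis
    by (auto simp: hardy_disc_def taylor_coeff_add intro!: holomorphic_intros)
qed

lemma hardy_disc_cmult:
  assumes "f \<in> hardy_disc"
  shows "(\<lambda>z. c * f z) \<in> hardy_disc"
  using assms
  by (auto simp: hardy_disc_def taylor_coeff_cmult norm_mult power_mult_distrib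
      intro!: holomorphic_intros summable_mult)

lemma hardy_disc_diff:
  assumes "f \<in> hardy_disc" "g \<in> hardy_disc"
  shows "(\<lambda>z. f z - g z) \<in> hardy_disc"
  using hardy_disc_add[OF assms(1) hardy_disc_cmult[OF assms(2), of "-1"]] by simp

lemma hardy_disc_shift:
  assumes "f \<in> hardy_disc"
  shows "(\<lambda>z. z * f z) \<in> hardy_disc"
proof -
  have "summable (\<lambda>n. (cmod (if n = 0 then 0 else taylor_coeff f (n - 1)))\<^sup>2)"
    by (subst summable_Suc_iff[symmetric]) (use assms in \<open>simp add: hardy_disc_summable\<close>)
  with assms show ?thesis
    by (auto simp: hardy_disc_def taylor_coeff_shift intro!: holomorphic_intros)
qed

lemma hardy_disc_backward_shift:
  assumes "f \<in> hardy_disc"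
  shows "backward_shift f \<in> hardy_disc"
proof -
  have "summable (\<lambda>n. (cmod (taylor_coeff f (Suc n)))\<^sup>2)"
    by (subst summable_Suc_iff[where f="\<lambda>n. (cmod (taylor_coeff f n))\<^sup>2"]) (use assms in \<open>simp add: hardy_disc_summable\<close>)
  with assms show ?thesis
    by (auto simp: hardy_disc_def taylor_coeff_backward_shift intro!: holomorphic_backward_shift)
qed

text \<open>Absolute convergence follows from 2 x y \<le> x^2 + y^2 for the moduli of the
  coefficients. It is what makes the defining infinite sum additive and homogeneous.\<close>

lemma hardy_disc_inner_sums:
  assumes "f \<in> hardy_disc" "g \<in> hardy_disc"
  shows "(\<lambda>n. taylor_coeff f n * cnj (taylor_coeff g n)) sums hardy_disc_inner f g"
  unfolding hardy_disc_inner_def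
proof (rule summable_sums, rule summable_norm_cancel, rule summable_comparison_test')
  show "summable (\<lambda>n. (cmod (taylor_coeff f n))\<^sup>2 + (cmod (taylor_coeff g n))\<^sup>2)"
    using assms by (intro summable_add hardy_disc_summable)
  fix n
  have "2 * (cmod (taylor_coeff f n) * cmod (taylor_coeff g n))
      \<le> (cmod (taylor_coeff f n))\<^sup>2 + (cmod (taylor_coeff g n))\<^sup>2"
    using zero_le_power2[of "cmod (taylor_coeff f n) - cmod (taylor_coeff g n)"]
    by (simp add: power2_diff)
  moreover have "0 \<le> cmod (taylor_coeff f n) * cmod (taylor_coeff g n)" by simp
  ultimately show "norm (norm (taylor_coeff f n * cnj (taylor_coeff g n)))
      \<le> (cmod (taylor_coeff f n))\<^sup>2 + (cmod (taylor_coeff g n))\<^sup>2"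
    unfolding real_norm_def abs_norm_cancel norm_mult complex_mod_cnj by linarith
qed

lemma hardy_disc_inner_cong:
  assumes "\<And>z. z \<in> disc \<Longrightarrow> f z = f' z" "\<And>z. z \<in> disc \<Longrightarrow> g z = g' z"
  shows "hardy_disc_inner f g = hardy_disc_inner f' g'"
  using taylor_coeff_cong[of f f'] taylor_coeff_cong[of g g'] assms by (simp add: hardy_disc_inner_def)

lemma hardy_disc_inner_commute:
  assumes "f \<in> hardy_disc" "g \<in> hardy_disc"
  shows "hardy_disc_inner g f = cnj (hardy_disc_inner f g)"
proof (rule sums_unique2)
  show "(\<lambda>n. taylor_coeff g n * cnj (taylor_coeff f n)) sums hardy_disc_inner g f"
    using assms by (intro hardy_disc_inner_sums)
  have "(\<lambda>n. cnj (taylor_coeff f n * cnj (taylor_coeff g n))) sums cnj (hardy_disc_inner f g)"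
    by (intro sums_cnj[THEN iffD2] hardy_disc_inner_sums assms)
  then show "(\<lambda>n. taylor_coeff g n * cnj (taylor_coeff f n)) sums cnj (hardy_disc_inner f g)"
    by (simp add: mult.commute)
qed

lemma hardy_disc_inner_add_left:
  assumes "f \<in> hardy_disc" "g \<in> hardy_disc" "h \<in> hardy_disc"
  shows "hardy_disc_inner (\<lambda>z. f z + g z) h = hardy_disc_inner f h + hardy_disc_inner g h"
proof -
  have "(\<lambda>n. taylor_coeff (\<lambda>z. f z + g z) n * cnj (taylor_coeff h n))
      sums (hardy_disc_inner f h + hardy_disc_inner g h)"
    using assms sums_add[OF hardy_disc_inner_sums hardy_disc_inner_sums, of f h g h]
    by (simp add: taylor_coeff_add hardy_disc_holomorphic distrib_right)
  then show ?thesis unfolding hardy_disc_inner_def by (simp add: sums_iff)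
qed

lemma hardy_disc_inner_cmult_left:
  assumes "f \<in> hardy_disc" "h \<in> hardy_disc"
  shows "hardy_disc_inner (\<lambda>z. c * f z) h = c * hardy_disc_inner f h"
proof -
  have "(\<lambda>n. taylor_coeff (\<lambda>z. c * f z) n * cnj (taylor_coeff h n)) sums (c * hardy_disc_inner f h)"
    using assms sums_mult[OF hardy_disc_inner_sums, of f h c]
    by (simp add: taylor_coeff_cmult hardy_disc_holomorphic mult.assoc)
  then show ?thesis unfolding hardy_disc_inner_def by (simp add: sums_iff)
qed

lemma hardy_disc_inner_add_right:
  assumes "f \<in> hardy_disc" "g \<in> hardy_disc" "h \<in> hardy_disc"
  shows "hardy_disc_inner h (\<lambda>z. f z + g z) = hardy_disc_inner h f + hardy_disc_inner h g"
  using hardy_disc_inner_add_left[OF assms] assms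
  by (simp add: hardy_disc_inner_commute[of _ h] hardy_disc_add)

lemma hardy_disc_inner_cmult_right:
  assumes "f \<in> hardy_disc" "h \<in> hardy_disc"
  shows "hardy_disc_inner h (\<lambda>z. c * f z) = cnj c * hardy_disc_inner h f"
  using hardy_disc_inner_cmult_left[OF assms] assms
  by (simp add: hardy_disc_inner_commute[of _ h] hardy_disc_cmult)

lemma hardy_disc_inner_diff_left:
  assumes "f \<in> hardy_disc" "g \<in> hardy_disc" "h \<in> hardy_disc"
  shows "hardy_disc_inner (\<lambda>z. f z - g z) h = hardy_disc_inner f h - hardy_disc_inner g h"
  using hardy_disc_inner_add_left[OF assms(1) hardy_disc_cmult[OF assms(2), of "-1"] assms(3)]
    hardy_disc_inner_cmult_left[OF assms(2,3), of "-1"] by simp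

lemma hardy_disc_inner_const_left: "hardy_disc_inner (\<lambda>_. c) h = c * cnj (h 0)"
proof -
  have "(\<lambda>n. taylor_coeff (\<lambda>_. c) n * cnj (taylor_coeff h n)) = (\<lambda>n. if n = 0 then c * cnj (h 0) else 0)"
    by (auto simp: taylor_coeff_const fun_eq_iff)
  then show ?thesis
    using sums_If_finite_set[of "{0::nat}" "\<lambda>_. c * cnj (h 0)"] unfolding hardy_disc_inner_def
    by (auto simp: sums_iff)
qed

text \<open>The backward shift is the adjoint of multiplication by z: the term of index 0 on the
  left vanishes and the others are reindexed by one.\<close>

lemma hardy_disc_inner_shift_left:
  assumes "f \<in> hardy_disc" "g \<in> hardy_disc"
  shows "hardy_disc_inner (\<lambda>z. z * f z) g = hardy_disc_inner f (backward_shift g)"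
proof -
  have "(\<lambda>n. taylor_coeff f n * cnj (taylor_coeff g (Suc n))) sums hardy_disc_inner f (backward_shift g)"
    using hardy_disc_inner_sums[OF assms(1) hardy_disc_backward_shift[OF assms(2)]] assms
    by (simp add: taylor_coeff_backward_shift hardy_disc_holomorphic)
  then have "(\<lambda>n. taylor_coeff (\<lambda>z. z * f z) n * cnj (taylor_coeff g n)) sums hardy_disc_inner f (backward_shift g)"
    using assms sums_Suc_iff[where f="\<lambda>n. taylor_coeff (\<lambda>z. z * f z) n * cnj (taylor_coeff g n)"
        and s="hardy_disc_inner f (backward_shift g)"]
    by (simp add: taylor_coeff_shift hardy_disc_holomorphic)
  then show ?thesis unfolding hardy_disc_inner_def by (simp add: sums_iff)
qed

lemma hardy_disc_inner_shift_shift: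
  assumes "f \<in> hardy_disc" "g \<in> hardy_disc"
  shows "hardy_disc_inner (\<lambda>z. z * f z) (\<lambda>z. z * g z) = hardy_disc_inner f g"
proof -
  have "taylor_coeff (backward_shift (\<lambda>z. z * g z)) = taylor_coeff g"
    using assms hardy_disc_shift[of g]
    by (simp add: taylor_coeff_backward_shift taylor_coeff_shift hardy_disc_holomorphic)
  then show ?thesis
    using hardy_disc_inner_shift_left[OF assms(1) hardy_disc_shift[OF assms(2)]]
    by (simp add: hardy_disc_inner_def)
qed

definition hardy_disc_sqnorm :: "(complex \<Rightarrow> complex) \<Rightarrow> real" where
  "hardy_disc_sqnorm f = (\<Sum>n. (cmod (taylor_coeff f n))\<^sup>2)"

lemma hardy_disc_inner_self:
  assumes "f \<in> hardy_disc"
  shows "hardy_disc_inner f f = complex_of_real (hardy_disc_sqnorm f)"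
proof -
  have "(\<lambda>n. taylor_coeff f n * cnj (taylor_coeff f n)) sums complex_of_real (hardy_disc_sqnorm f)"
    using summable_sums[OF hardy_disc_summable[OF assms]]
    unfolding complex_norm_square[symmetric] hardy_disc_sqnorm_def by (intro sums_of_real)
  then show ?thesis unfolding hardy_disc_inner_def by (simp add: sums_iff)
qed

lemma hardy_disc_coeff_le_sqnorm:
  assumes "f \<in> hardy_disc"
  shows "(\<Sum>n\<in>A. (cmod (taylor_coeff f n))\<^sup>2) \<le> hardy_disc_sqnorm f"
proof (cases "finite A")
  case True
  then show ?thesis
    unfolding hardy_disc_sqnorm_def by (intro sum_le_suminf hardy_disc_summable assms) auto
next
  \<comment> \<open>A sum over an infinite index set is 0 by convention, so only nonnegativity of
    the norm is at stake.\<close>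
  case False
  then show ?thesis
    unfolding hardy_disc_sqnorm_def by (simp add: suminf_nonneg hardy_disc_summable assms)
qed

section \<open>Parseval on circles and multiplication by bounded functions\<close>

lemma has_integral_cis_multiple:
  fixes k :: int
  shows "((\<lambda>t. cis (of_int k * t)) has_integral (if k = 0 then 2 * pi else 0)) {0..2*pi}"
proof (cases "k = 0")
  case True
  then show ?thesis using has_integral_const_real[of "1::complex" 0 "2*pi"] by (simp add: scaleR_conv_of_real)
next
  case False
  \<comment> \<open>For nonzero \<open>k\<close> there is a periodic primitive, whose values at the
    two endpoints cancel.\<close>
  have "((\<lambda>t. cis (of_int k * t)) has_integral
      (cis (of_int k * (2*pi)) / (\<i> * of_int k) - cis (of_int k * 0) / (\<i> * of_int k))) {0..2*pi}"
  proof (rule fundamental_theorem_of_calculus)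
    fix t :: real assume "t \<in> {0..2*pi}"
    have "((\<lambda>z. exp (\<i> * of_int k * z)) has_field_derivative (\<i> * of_int k * exp (\<i> * of_int k * of_real t))) (at (of_real t))"
      by (rule derivative_eq_intros refl | simp)+
    from has_vector_derivative_real_field[OF this]
    have "((\<lambda>t. cis (of_int k * t)) has_vector_derivative (\<i> * of_int k * cis (of_int k * t))) (at t within {0..2*pi})"
      by (simp add: cis_conv_exp mult.assoc)
    from has_vector_derivative_divide[OF this, of "\<i> * of_int k"] False
    show "((\<lambda>t. cis (of_int k * t) / (\<i> * of_int k)) has_vector_derivative cis (of_int k * t)) (at t within {0..2*pi})"
      by simp
  qed simp
  moreover have "cis (of_int k * (2*pi)) = 1"
    using cis_multiple_2pi[of "of_int k"] by (simp add: mult.commute)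
  ultimately show ?thesis using False by simp
qed

text \<open>Partial sums are trigonometric polynomials, for which orthogonality of the exponentials
  gives the formula. They are bounded by the sum of the moduli of the \<open>a n\<close>, so
  dominated convergence with a constant majorant passes to the limit.\<close>

lemma circle_parseval:
  fixes r :: real
  assumes f: "f holomorphic_on disc" and r: "0 \<le> r" "r < 1"
  shows "((\<lambda>t. (cmod (f (of_real r * cis t)))\<^sup>2) has_integral
      (2 * pi * (\<Sum>n. (cmod (taylor_coeff f n))\<^sup>2 * r ^ (2 * n)))) {0..2*pi}" (is ?I)
    and "summable (\<lambda>n. (cmod (taylor_coeff f n))\<^sup>2 * r ^ (2 * n))" (is ?S)
proof -
  define a where "a n = taylor_coeff f n * of_real r ^ n" for n
  define p where "p K t = (\<Sum>n<K. a n * cis (of_nat n * t))" for K t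
  have circ: "of_real r * cis t \<in> disc" for t using r by (simp add: norm_mult)
  have sa: "summable (\<lambda>n. cmod (a n))"
  proof -
    \<comment> \<open>Convergence at a radius strictly between \<open>r\<close> and 1 gives absolute
      convergence at \<open>r\<close>.\<close>
    have "of_real ((1 + r) / 2) \<in> disc" using r by (simp del: of_real_divide of_real_add)
    from taylor_coeff_sums[OF f this] have "summable (\<lambda>n. taylor_coeff f n * (of_real ((1 + r) / 2)) ^ n)"
      by (simp add: sums_iff)
    from powser_insidea[OF this, of "of_real r"] r show ?thesis
      unfolding a_def by (simp del: of_real_divide of_real_add)
  qed
  have lim: "(\<lambda>K. p K t) \<longlonglongrightarrow> f (of_real r * cis t)" for t
    using taylor_coeff_sums[OF f circ, of t] unfolding sums_def p_def a_def
    by (simp add: power_mult_distrib Complex.DeMoivre mult_ac)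
  have bound: "cmod (p K t) \<le> (\<Sum>n. cmod (a n))" for K t
  proof -
    have "cmod (p K t) \<le> (\<Sum>n<K. cmod (a n))"
      unfolding p_def by (rule order_trans[OF norm_sum]) (simp add: norm_mult)
    also have "\<dots> \<le> (\<Sum>n. cmod (a n))" by (intro sum_le_suminf sa) auto
    finally show ?thesis .
  qed
  have pint: "((\<lambda>t. (cmod (p K t))\<^sup>2) has_integral (2 * pi * (\<Sum>n<K. (cmod (a n))\<^sup>2))) {0..2*pi}" for K
  proof -
    have eq: "p K t * cnj (p K t) = (\<Sum>n<K. \<Sum>m<K. a n * cnj (a m) * cis (of_int (int n - int m) * t))" for t
    proof -
      have "a n * cis (of_nat n * t) * cnj (a m * cis (of_nat m * t))
          = a n * cnj (a m) * cis (of_int (int n - int m) * t)" for n m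
        using cis_mult[of "of_nat n * t" "- (of_nat m * t)"] by (simp add: cis_cnj algebra_simps)
      then show ?thesis unfolding p_def by (simp only: cnj_sum sum_product)
    qed
    have "((\<lambda>t. p K t * cnj (p K t)) has_integral
        (\<Sum>n<K. \<Sum>m<K. a n * cnj (a m) * (if int n - int m = 0 then 2 * pi else 0))) {0..2*pi}"
      unfolding eq by (intro has_integral_sum has_integral_mult_right has_integral_cis_multiple) auto
    also have "(\<Sum>n<K. \<Sum>m<K. a n * cnj (a m) * (if int n - int m = 0 then 2 * pi else 0))
        = complex_of_real (2 * pi * (\<Sum>n<K. (cmod (a n))\<^sup>2))"
      by (simp add: if_distrib sum_distrib_left complex_norm_square[symmetric] mult_ac cong: if_cong)
    finally have "((\<lambda>t. complex_of_real ((cmod (p K t))\<^sup>2)) has_integral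
        complex_of_real (2 * pi * (\<Sum>n<K. (cmod (a n))\<^sup>2))) {0..2*pi}"
      unfolding complex_norm_square[symmetric] .
    from has_integral_Re[OF this] show ?thesis by simp
  qed
  have sq: "summable (\<lambda>n. (cmod (a n))\<^sup>2)"
  proof (rule summable_comparison_test')
    show "summable (\<lambda>n. (\<Sum>n. cmod (a n)) * cmod (a n))" by (intro summable_mult sa)
    show "norm ((cmod (a n))\<^sup>2) \<le> (\<Sum>n. cmod (a n)) * cmod (a n)" for n
      using sum_le_suminf[OF sa, of "{n}"] by (simp add: power2_eq_square mult_right_mono)
  qed
  have pi: "(\<lambda>t. (cmod (p K t))\<^sup>2) integrable_on {0..2*pi}" for K
    using pint by (rule has_integral_integrable)
  have pb: "norm ((cmod (p K t))\<^sup>2) \<le> (\<Sum>n. cmod (a n))\<^sup>2" for K t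
    using power_mono[OF bound norm_ge_zero] by simp
  have pl: "(\<lambda>K. (cmod (p K t))\<^sup>2) \<longlonglongrightarrow> (cmod (f (of_real r * cis t)))\<^sup>2" for t
    by (intro tendsto_intros lim)
  have hc: "(\<lambda>_. (\<Sum>n. cmod (a n))\<^sup>2) integrable_on {0..2*pi}"
    by (rule integrable_const_ivl)
  note int = dominated_convergence(1)[OF pi hc pb pl]
    and ilim = dominated_convergence(2)[OF pi hc pb pl]
  have e: "(cmod (a n))\<^sup>2 = (cmod (taylor_coeff f n))\<^sup>2 * r ^ (2 * n)" for n
    using r by (simp add: a_def norm_mult norm_power power_mult_distrib power_even_eq)
  have "integral {0..2*pi} (\<lambda>t. (cmod (f (of_real r * cis t)))\<^sup>2) = 2 * pi * (\<Sum>n. (cmod (a n))\<^sup>2)"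
  proof (rule LIMSEQ_unique[OF ilim])
    show "(\<lambda>K. integral {0..2*pi} (\<lambda>t. (cmod (p K t))\<^sup>2)) \<longlonglongrightarrow> 2 * pi * (\<Sum>n. (cmod (a n))\<^sup>2)"
      unfolding integral_unique[OF pint] by (intro tendsto_intros summable_LIMSEQ sq)
  qed
  with integrable_integral[OF int] show ?I unfolding e by simp
  show ?S using sq unfolding e .
qed

text \<open>On each circle of radius r < 1 the pointwise bound on \<open>f\<close> integrates,
  through Parseval, to a bound for the weighted coefficient sums; then r tends to 1.\<close>

lemma hardy_disc_mult_bounded:
  assumes f: "f holomorphic_on disc" and M: "\<And>z. z \<in> disc \<Longrightarrow> cmod (f z) \<le> M"
    and g: "g \<in> hardy_disc"
  shows "(\<lambda>z. f z * g z) \<in> hardy_disc"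
    and "hardy_disc_sqnorm (\<lambda>z. f z * g z) \<le> M\<^sup>2 * hardy_disc_sqnorm g"
proof -
  let ?c = "taylor_coeff (\<lambda>z. f z * g z)"
  have hg: "g holomorphic_on disc" using g by (rule hardy_disc_holomorphic)
  have hfg: "(\<lambda>z. f z * g z) holomorphic_on disc" by (intro holomorphic_intros f hg)
  have r: "(\<Sum>n<K. (cmod (?c n))\<^sup>2 * r ^ (2 * n)) \<le> M\<^sup>2 * hardy_disc_sqnorm g" if "0 \<le> r" "r < 1" for r K
  proof -
    have circ: "of_real r * cis t \<in> disc" for t using that by (simp add: norm_mult)
    have "2 * pi * (\<Sum>n. (cmod (?c n))\<^sup>2 * r ^ (2 * n))
        \<le> M\<^sup>2 * (2 * pi * (\<Sum>n. (cmod (taylor_coeff g n))\<^sup>2 * r ^ (2 * n)))"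
    proof (rule has_integral_le)
      show "((\<lambda>t. M\<^sup>2 * (cmod (g (of_real r * cis t)))\<^sup>2) has_integral
          (M\<^sup>2 * (2 * pi * (\<Sum>n. (cmod (taylor_coeff g n))\<^sup>2 * r ^ (2 * n))))) {0..2*pi}"
        by (intro has_integral_mult_right circle_parseval hg that)
      show "(cmod (f (of_real r * cis t) * g (of_real r * cis t)))\<^sup>2 \<le> M\<^sup>2 * (cmod (g (of_real r * cis t)))\<^sup>2" for t
        unfolding norm_mult power_mult_distrib by (intro mult_right_mono power_mono M circ) auto
    qed (rule circle_parseval[OF hfg that])
    then have "(\<Sum>n. (cmod (?c n))\<^sup>2 * r ^ (2 * n))
        \<le> M\<^sup>2 * (\<Sum>n. (cmod (taylor_coeff g n))\<^sup>2 * r ^ (2 * n))"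
      by (simp add: mult.left_commute[of _ "2 * pi"] mult.assoc)
    also have "\<dots> \<le> M\<^sup>2 * hardy_disc_sqnorm g"
      unfolding hardy_disc_sqnorm_def using that
      by (intro mult_left_mono suminf_le circle_parseval hg hardy_disc_summable g)
        (auto intro!: mult_left_le power_le_one)
    finally have *: "(\<Sum>n. (cmod (?c n))\<^sup>2 * r ^ (2 * n)) \<le> M\<^sup>2 * hardy_disc_sqnorm g" .
    have "(\<Sum>n<K. (cmod (?c n))\<^sup>2 * r ^ (2 * n)) \<le> (\<Sum>n. (cmod (?c n))\<^sup>2 * r ^ (2 * n))"
      using that by (intro sum_le_suminf circle_parseval hfg) auto
    with * show ?thesis by simp
  qed
  \<comment> \<open>A finite partial sum is continuous in r, so the bound survives the limit r to 1;
    only afterwards does \<open>K\<close> grow.\<close>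
  have K: "(\<Sum>n<K. (cmod (?c n))\<^sup>2) \<le> M\<^sup>2 * hardy_disc_sqnorm g" for K
  proof (rule tendsto_upperbound)
    have "((\<lambda>r. \<Sum>n<K. (cmod (?c n))\<^sup>2 * r ^ (2 * n)) \<longlongrightarrow> (\<Sum>n<K. (cmod (?c n))\<^sup>2 * 1 ^ (2 * n))) (at_left (1::real))"
      by (intro tendsto_intros)
    then show "((\<lambda>r. \<Sum>n<K. (cmod (?c n))\<^sup>2 * r ^ (2 * n)) \<longlongrightarrow> (\<Sum>n<K. (cmod (?c n))\<^sup>2)) (at_left (1::real))"
      by simp
    have "eventually (\<lambda>r::real. r \<in> {0<..<1}) (at_left 1)"
      by (rule eventually_at_left_real) simp
    then show "eventually (\<lambda>r. (\<Sum>n<K. (cmod (?c n))\<^sup>2 * r ^ (2 * n)) \<le> M\<^sup>2 * hardy_disc_sqnorm g) (at_left (1::real))"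
      by eventually_elim (rule r, auto)
  qed simp
  have s: "summable (\<lambda>n. (cmod (?c n))\<^sup>2)"
    by (rule summableI_nonneg_bounded[OF _ K]) simp
  with hfg show "(\<lambda>z. f z * g z) \<in> hardy_disc" by (simp add: hardy_disc_def)
  show "hardy_disc_sqnorm (\<lambda>z. f z * g z) \<le> M\<^sup>2 * hardy_disc_sqnorm g"
    unfolding hardy_disc_sqnorm_def[of "\<lambda>z. f z * g z"] by (rule suminf_le_const[OF s K])
qed

section \<open>Isometric multipliers and model spaces\<close>

text \<open>A norm-theoretic form of being inner. Since no boundary values enter, products and
  quotients are handled by algebra.\<close>

definition isometric_multiplier :: "(complex \<Rightarrow> complex) \<Rightarrow> bool" where
  "isometric_multiplier \<theta> \<longleftrightarrow> \<theta> holomorphic_on disc \<and> bounded (\<theta> ` disc) \<and>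
     (\<forall>g\<in>hardy_disc. hardy_disc_sqnorm (\<lambda>z. \<theta> z * g z) = hardy_disc_sqnorm g)"

lemma isometric_multiplier_holomorphic: "isometric_multiplier \<theta> \<Longrightarrow> \<theta> holomorphic_on disc"
  by (simp add: isometric_multiplier_def)

lemma hardy_disc_bounded_mult:
  assumes "\<theta> holomorphic_on disc" "bounded (\<theta> ` disc)" "g \<in> hardy_disc"
  shows "(\<lambda>z. \<theta> z * g z) \<in> hardy_disc"
proof -
  obtain M where "\<And>z. z \<in> disc \<Longrightarrow> cmod (\<theta> z) \<le> M"
    using assms(2) unfolding bounded_iff by blast
  then show ?thesis using assms by (intro hardy_disc_mult_bounded(1)[of \<theta> M g]) auto
qed

lemma isometric_multiplier_mult_in:
  "isometric_multiplier \<theta> \<Longrightarrow> g \<in> hardy_disc \<Longrightarrow> (\<lambda>z. \<theta> z * g z) \<in> hardy_disc"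
  by (auto simp: isometric_multiplier_def intro: hardy_disc_bounded_mult)

lemma isometric_multiplier_in: "isometric_multiplier \<theta> \<Longrightarrow> \<theta> \<in> hardy_disc"
  using isometric_multiplier_mult_in[OF _ hardy_disc_const, of \<theta> 1] by simp

lemma hardy_disc_sqnorm_cong:
  assumes "\<And>z. z \<in> disc \<Longrightarrow> f z = g z"
  shows "hardy_disc_sqnorm f = hardy_disc_sqnorm g"
  using taylor_coeff_cong[of f g] assms by (simp add: hardy_disc_sqnorm_def)

lemma hardy_disc_sqnorm_add:
  assumes "f \<in> hardy_disc" "g \<in> hardy_disc"
  shows "hardy_disc_sqnorm (\<lambda>z. f z + g z)
    = hardy_disc_sqnorm f + hardy_disc_sqnorm g + 2 * Re (hardy_disc_inner f g)"
proof -
  have "complex_of_real (hardy_disc_sqnorm (\<lambda>z. f z + g z))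
      = hardy_disc_inner f f + hardy_disc_inner g g + (hardy_disc_inner f g + cnj (hardy_disc_inner f g))"
    using assms
    by (simp add: hardy_disc_inner_self[symmetric] hardy_disc_add hardy_disc_inner_add_left
        hardy_disc_inner_add_right hardy_disc_inner_commute[of f g])
  then have "complex_of_real (hardy_disc_sqnorm (\<lambda>z. f z + g z)) = complex_of_real
      (hardy_disc_sqnorm f + hardy_disc_sqnorm g + 2 * Re (hardy_disc_inner f g))"
    using assms by (simp add: hardy_disc_inner_self complex_add_cnj)
  then show ?thesis by (simp only: of_real_eq_iff)
qed

lemma hardy_disc_sqnorm_cmult:
  assumes "f \<in> hardy_disc"
  shows "hardy_disc_sqnorm (\<lambda>z. c * f z) = (cmod c)\<^sup>2 * hardy_disc_sqnorm f"
  using assms unfolding hardy_disc_sqnorm_def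
  by (simp add: taylor_coeff_cmult hardy_disc_holomorphic norm_mult power_mult_distrib
      suminf_mult hardy_disc_summable)

lemma hardy_disc_sqnorm_const: "hardy_disc_sqnorm (\<lambda>_. c) = (cmod c)\<^sup>2"
  using hardy_disc_inner_self[OF hardy_disc_const, of c]
  unfolding hardy_disc_inner_const_left complex_norm_square[symmetric] of_real_eq_iff by simp

lemma hardy_disc_sqnorm_shift:
  assumes "f \<in> hardy_disc"
  shows "hardy_disc_sqnorm (\<lambda>z. z * f z) = hardy_disc_sqnorm f"
  using hardy_disc_inner_shift_shift[OF assms assms] assms
  by (simp add: hardy_disc_inner_self hardy_disc_shift)

text \<open>Polarisation: the norm of \<open>f + g\<close> determines the real part of the inner
  product, and replacing \<open>g\<close> by \<i> times \<open>g\<close> yields the imaginary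
  part.\<close>

lemma isometric_multiplier_inner:
  assumes "isometric_multiplier \<theta>" and f: "f \<in> hardy_disc" and g: "g \<in> hardy_disc"
  shows "hardy_disc_inner (\<lambda>z. \<theta> z * f z) (\<lambda>z. \<theta> z * g z) = hardy_disc_inner f g"
proof -
  have iso: "hardy_disc_sqnorm (\<lambda>z. \<theta> z * g z) = hardy_disc_sqnorm g" if "g \<in> hardy_disc" for g
    using assms(1) that unfolding isometric_multiplier_def by blast
  have re: "Re (hardy_disc_inner (\<lambda>z. \<theta> z * f z) (\<lambda>z. \<theta> z * g z)) = Re (hardy_disc_inner f g)"
    if "g \<in> hardy_disc" for g
  proof -
    have "hardy_disc_sqnorm (\<lambda>z. \<theta> z * f z + \<theta> z * g z) = hardy_disc_sqnorm (\<lambda>z. f z + g z)"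
      using iso[OF hardy_disc_add[OF f that]] by (simp add: distrib_left)
    then show ?thesis
      using f that iso by (simp add: hardy_disc_sqnorm_add isometric_multiplier_mult_in[OF assms(1)])
  qed
  have "Im (hardy_disc_inner (\<lambda>z. \<theta> z * f z) (\<lambda>z. \<theta> z * g z)) = Im (hardy_disc_inner f g)"
    using re[OF hardy_disc_cmult[OF g, of \<i>]]
      hardy_disc_inner_cmult_right[OF g f, of \<i>]
      hardy_disc_inner_cmult_right[OF isometric_multiplier_mult_in[OF assms(1) g]
        isometric_multiplier_mult_in[OF assms(1) f], of \<i>]
    by (simp add: mult.left_commute)
  with re[OF g] show ?thesis by (simp add: complex_eq_iff)
qed

lemma isometric_multiplier_cong:
  assumes "isometric_multiplier \<theta>" "\<And>z. z \<in> disc \<Longrightarrow> \<eta> z = \<theta> z"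
  shows "isometric_multiplier \<eta>"
proof -
  have "\<eta> ` disc = \<theta> ` disc" using assms(2) by auto
  moreover have "\<eta> holomorphic_on disc \<longleftrightarrow> \<theta> holomorphic_on disc"
    by (rule holomorphic_cong) (use assms in auto)
  moreover have "hardy_disc_sqnorm (\<lambda>z. \<eta> z * g z) = hardy_disc_sqnorm (\<lambda>z. \<theta> z * g z)" for g
    by (rule hardy_disc_sqnorm_cong) (use assms in auto)
  ultimately show ?thesis using assms(1) by (simp add: isometric_multiplier_def)
qed

lemma bounded_image_mult:
  fixes f g :: "'a \<Rightarrow> complex"
  assumes "bounded (f ` S)" "bounded (g ` S)"
  shows "bounded ((\<lambda>z. f z * g z) ` S)"
proof -
  obtain M N where "\<And>z. z \<in> S \<Longrightarrow> cmod (f z) \<le> M" "\<And>z. z \<in> S \<Longrightarrow> cmod (g z) \<le> N"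
    using assms unfolding bounded_iff by blast
  then have "norm (f z * g z) \<le> M * N" if "z \<in> S" for z
    unfolding norm_mult using that by (meson mult_mono norm_ge_zero order_trans)
  then show ?thesis unfolding bounded_iff by auto
qed

lemma isometric_multiplier_mult:
  assumes "isometric_multiplier \<eta>" "isometric_multiplier \<theta>"
  shows "isometric_multiplier (\<lambda>z. \<eta> z * \<theta> z)"
  using assms isometric_multiplier_mult_in[OF assms(2)]
  by (auto simp: isometric_multiplier_def mult.assoc intro!: holomorphic_intros bounded_image_mult)

text \<open>For \<open>g\<close> in H^2 the product of \<theta> and \<open>g\<close> is in H^2 by
  boundedness, so the isometry of \<eta> can be applied to that product and cancelled.\<close>

lemma isometric_multiplier_divide:
  assumes "isometric_multiplier \<eta>" "\<theta> holomorphic_on disc" "bounded (\<theta> ` disc)"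
    and "isometric_multiplier (\<lambda>z. \<eta> z * \<theta> z)"
  shows "isometric_multiplier \<theta>"
  using assms hardy_disc_bounded_mult[OF assms(2,3)]
  by (auto simp: isometric_multiplier_def mult.assoc)

lemma isometric_multiplier_const: "cmod c = 1 \<Longrightarrow> isometric_multiplier (\<lambda>_. c)"
  by (auto simp: isometric_multiplier_def hardy_disc_sqnorm_cmult bounded_iff)

lemma isometric_multiplier_sqnorm: "isometric_multiplier \<theta> \<Longrightarrow> hardy_disc_sqnorm \<theta> = 1"
  using hardy_disc_const[of 1] hardy_disc_sqnorm_const[of 1] unfolding isometric_multiplier_def by force

text \<open>The squared moduli of the coefficients add up to 1, so a value at 0 of modulus at least
  1 would leave nothing for the other coefficients.\<close>

lemma isometric_multiplier_norm_0:
  assumes "isometric_multiplier \<theta>" "\<not> \<theta> constant_on disc"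
  shows "cmod (\<theta> 0) < 1"
proof (rule ccontr)
  assume c: "\<not> cmod (\<theta> 0) < 1"
  then have c: "1 \<le> (cmod (\<theta> 0))\<^sup>2" by simp
  have "taylor_coeff \<theta> n = 0" if "n \<noteq> 0" for n
  proof -
    have "(cmod (\<theta> 0))\<^sup>2 + (cmod (taylor_coeff \<theta> n))\<^sup>2 \<le> 1"
      using hardy_disc_coeff_le_sqnorm[OF isometric_multiplier_in[OF assms(1)], of "{0, n}"] that
      by (simp add: isometric_multiplier_sqnorm[OF assms(1)])
    with c have "(cmod (taylor_coeff \<theta> n))\<^sup>2 \<le> 0" by linarith
    then show ?thesis by simp
  qed
  then have "(\<lambda>n. taylor_coeff \<theta> n * z ^ n) sums \<theta> 0" for z
    using sums_finite[of "{0}" "\<lambda>n. taylor_coeff \<theta> n * z ^ n"] by auto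
  then have "\<theta> z = \<theta> 0" if "z \<in> disc" for z
    using taylor_coeff_sums[OF isometric_multiplier_holomorphic[OF assms(1)] that] sums_unique2 by metis
  with assms(2) show False unfolding constant_on_def by blast
qed

lemma isometric_multiplier_norm_0_le:
  assumes "isometric_multiplier \<theta>"
  shows "cmod (\<theta> 0) \<le> 1"
  using hardy_disc_coeff_le_sqnorm[OF isometric_multiplier_in[OF assms], of "{0}"]
  by (simp add: isometric_multiplier_sqnorm[OF assms] power_le_one_iff)

text \<open>Schwarz--Pick at the origin. The test function \<open>x + y z\<close> with \<open>x = 1 - \<bar>\<theta> 0\<bar>\<^sup>2\<close> and
  \<open>y = cnj (\<theta> 0) \<theta>' 0\<close> is chosen so that the linear coefficient of its product with \<open>\<theta>\<close> is \<open>\<theta>' 0\<close>.\<close>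

lemma isometric_multiplier_schwarz_pick:
  assumes "isometric_multiplier \<theta>" "cmod (\<theta> 0) < 1"
  shows "cmod (taylor_coeff \<theta> 1) \<le> 1 - (cmod (\<theta> 0))\<^sup>2"
proof -
  define s where "s = 1 - (cmod (\<theta> 0))\<^sup>2"
  define y where "y = cnj (\<theta> 0) * taylor_coeff \<theta> 1"
  define p where "p z = complex_of_real s + z * y" for z
  have t2: "(cmod (\<theta> 0))\<^sup>2 = 1 - s" by (simp add: s_def)
  have s: "0 < s" using assms(2) by (simp add: s_def power_less_one_iff)
  have p: "p \<in> hardy_disc"
    unfolding p_def by (intro hardy_disc_add hardy_disc_const hardy_disc_shift)
  have sq: "hardy_disc_sqnorm p = s\<^sup>2 + (cmod y)\<^sup>2"
    unfolding p_def
    by (subst hardy_disc_sqnorm_add)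
      (auto intro: hardy_disc_const hardy_disc_shift
        simp: hardy_disc_sqnorm_const hardy_disc_sqnorm_shift[OF hardy_disc_const] hardy_disc_inner_const_left)
  have p0: "p 0 = s" by (simp add: p_def)
  have c1: "taylor_coeff p (Suc 0) = y"
    unfolding p_def by (subst taylor_coeff_add) (auto intro!: holomorphic_intros simp: taylor_coeff_const taylor_coeff_shift)
  have h: "\<theta> holomorphic_on disc" "p holomorphic_on disc"
    using assms p by (auto intro: isometric_multiplier_holomorphic hardy_disc_holomorphic)
  have "taylor_coeff (\<lambda>z. \<theta> z * p z) 1 = \<theta> 0 * y + taylor_coeff \<theta> 1 * s"
    unfolding taylor_coeff_mult[OF h] using c1 by (simp add: p_def)
  also have "\<dots> = taylor_coeff \<theta> 1 * (\<theta> 0 * cnj (\<theta> 0) + s)" by (simp add: y_def algebra_simps)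
  also have "\<theta> 0 * cnj (\<theta> 0) + s = 1" by (simp add: s_def complex_norm_square[symmetric])
  \<comment> \<open>Multiplication by \<theta> keeps the norm of \<open>p\<close>; of the product
    only the coefficients of index 0 and 1 are retained.\<close>
  finally have "(cmod (\<theta> 0 * s))\<^sup>2 + (cmod (taylor_coeff \<theta> 1))\<^sup>2 \<le> s\<^sup>2 + (cmod y)\<^sup>2"
    using hardy_disc_coeff_le_sqnorm[OF isometric_multiplier_mult_in[OF assms(1) p], of "{0,1}"] assms(1) p sq p0
    by (simp add: isometric_multiplier_def)
  then have "(1 - s) * s\<^sup>2 + (cmod (taylor_coeff \<theta> 1))\<^sup>2 \<le> s\<^sup>2 + (1 - s) * (cmod (taylor_coeff \<theta> 1))\<^sup>2"
    using s t2 by (simp add: y_def norm_mult power_mult_distrib)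
  then have "s * (cmod (taylor_coeff \<theta> 1))\<^sup>2 \<le> s * s\<^sup>2" by (simp add: algebra_simps)
  then have "(cmod (taylor_coeff \<theta> 1))\<^sup>2 \<le> s\<^sup>2" using s by simp
  then have "cmod (taylor_coeff \<theta> 1) \<le> s" using s by (simp add: power2_le_iff_abs_le)
  then show ?thesis unfolding s_def .
qed

section \<open>Model spaces and their kernel functions at the origin\<close>

lemma model_space_in: "f \<in> model_space \<theta> \<Longrightarrow> f \<in> hardy_disc"
  by (simp add: model_space_def)

lemma model_space_perp: "f \<in> model_space \<theta> \<Longrightarrow> g \<in> hardy_disc \<Longrightarrow> hardy_disc_inner f (\<lambda>z. \<theta> z * g z) = 0"
  by (simp add: model_space_def)

lemma model_space_cong:
  assumes "\<And>z. z \<in> disc \<Longrightarrow> \<eta> z = \<theta> z"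
  shows "model_space \<eta> = model_space \<theta>"
proof -
  have "hardy_disc_inner f (\<lambda>z. \<eta> z * g z) = hardy_disc_inner f (\<lambda>z. \<theta> z * g z)" for f g
    by (rule hardy_disc_inner_cong) (use assms in auto)
  then show ?thesis unfolding model_space_def by simp
qed

text \<open>Multiples of the product are in particular multiples of \<eta>, so the orthogonal
  complement can only grow.\<close>

lemma model_space_mono:
  assumes "isometric_multiplier \<theta>" "f \<in> model_space \<eta>"
  shows "f \<in> model_space (\<lambda>z. \<eta> z * \<theta> z)"
  using assms(2) isometric_multiplier_mult_in[OF assms(1)]
  by (auto simp: model_space_def mult.assoc)

text \<open>Multiplication by \<eta> preserves inner products, so orthogonality to the multiples of
  \<theta> becomes orthogonality to the multiples of the product.\<close>

lemma model_space_mult: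
  assumes "isometric_multiplier \<eta>" "isometric_multiplier \<theta>" "f \<in> model_space \<theta>"
  shows "(\<lambda>z. \<eta> z * f z) \<in> model_space (\<lambda>z. \<eta> z * \<theta> z)"
  using assms(3) isometric_multiplier_inner[OF assms(1)] isometric_multiplier_mult_in[OF assms(1)]
    isometric_multiplier_mult_in[OF assms(2)]
  by (auto simp: model_space_def mult.assoc)

text \<open>The multiples of \<theta> are invariant under multiplication by z, hence their
  complement is invariant under its adjoint.\<close>

lemma model_space_backward_shift:
  assumes "isometric_multiplier \<theta>" "f \<in> model_space \<theta>"
  shows "backward_shift f \<in> model_space \<theta>"
proof -
  note f = model_space_in[OF assms(2)]
  have "hardy_disc_inner (backward_shift f) (\<lambda>z. \<theta> z * g z) = 0" if g: "g \<in> hardy_disc" for g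
  proof -
    have g': "(\<lambda>z. \<theta> z * g z) \<in> hardy_disc" by (rule isometric_multiplier_mult_in[OF assms(1) g])
    have "hardy_disc_inner (backward_shift f) (\<lambda>z. \<theta> z * g z) = cnj (hardy_disc_inner (\<lambda>z. \<theta> z * g z) (backward_shift f))"
      by (intro hardy_disc_inner_commute hardy_disc_backward_shift f g')
    also have "\<dots> = cnj (hardy_disc_inner (\<lambda>z. z * (\<theta> z * g z)) f)"
      by (subst hardy_disc_inner_shift_left) (use f g' in auto)
    also have "\<dots> = hardy_disc_inner f (\<lambda>z. \<theta> z * (z * g z))"
      by (subst hardy_disc_inner_commute[of "\<lambda>z. z * (\<theta> z * g z)" f, symmetric]) (use f g' hardy_disc_shift in \<open>auto simp: mult_ac\<close>)
    also have "\<dots> = 0" by (intro model_space_perp[OF assms(2)] hardy_disc_shift g)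
    finally show ?thesis .
  qed
  with f show ?thesis unfolding model_space_def by (auto intro: hardy_disc_backward_shift)
qed

text \<open>This function is the orthogonal projection of the constant 1 to the model space, that
  is, its reproducing kernel at 0; the subtracted term is the component of 1 along the multiples of
  \<theta>.\<close>

lemma model_space_kernel:
  assumes "isometric_multiplier \<theta>"
  shows "(\<lambda>z. 1 - cnj (\<theta> 0) * \<theta> z) \<in> model_space \<theta>" (is "?k \<in> _")
    and "hardy_disc_sqnorm (\<lambda>z. 1 - cnj (\<theta> 0) * \<theta> z) = 1 - (cmod (\<theta> 0))\<^sup>2"
proof -
  note t = isometric_multiplier_in[OF assms]
  have k: "?k \<in> hardy_disc" by (intro hardy_disc_diff hardy_disc_const hardy_disc_cmult t)
  have "hardy_disc_inner ?k (\<lambda>z. \<theta> z * g z) = 0" if g: "g \<in> hardy_disc" for g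
  proof -
    have g': "(\<lambda>z. \<theta> z * g z) \<in> hardy_disc" by (rule isometric_multiplier_mult_in[OF assms g])
    have "hardy_disc_inner \<theta> (\<lambda>z. \<theta> z * g z) = cnj (g 0)"
      using isometric_multiplier_inner[OF assms hardy_disc_const g, of 1] by (simp add: hardy_disc_inner_const_left)
    then show ?thesis
      using t g' by (simp add: hardy_disc_inner_diff_left hardy_disc_const hardy_disc_cmult
          hardy_disc_inner_cmult_left hardy_disc_inner_const_left)
  qed
  with k show "?k \<in> model_space \<theta>" by (simp add: model_space_def)
  have "hardy_disc_sqnorm ?k = hardy_disc_sqnorm (\<lambda>z. 1 + (- cnj (\<theta> 0)) * \<theta> z)" by simp
  also have "\<dots> = 1 - (cmod (\<theta> 0))\<^sup>2"
    unfolding hardy_disc_sqnorm_add[OF hardy_disc_const hardy_disc_cmult[OF t]] hardy_disc_sqnorm_cmult[OF t]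
      hardy_disc_sqnorm_const hardy_disc_inner_const_left isometric_multiplier_sqnorm[OF assms]
    by (simp add: cmod_power2) (simp add: power2_eq_square)
  finally show "hardy_disc_sqnorm ?k = 1 - (cmod (\<theta> 0))\<^sup>2" .
qed

text \<open>The subspace \<open>z \<theta> H\<^sup>2\<close> is already orthogonal to \<open>z e\<close>,
  so the compressed shift only removes the component along \<open>\<theta>\<close>.\<close>

lemma model_space_shift_project:
  assumes "isometric_multiplier \<theta>" "e \<in> model_space \<theta>"
  defines "c \<equiv> hardy_disc_inner (\<lambda>z. z * e z) \<theta>"
  shows "(\<lambda>z. z * e z - c * \<theta> z) \<in> model_space \<theta>"
proof -
  note t = isometric_multiplier_in[OF assms(1)]
  have e: "(\<lambda>z. z * e z) \<in> hardy_disc" by (intro hardy_disc_shift model_space_in[OF assms(2)])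
  have "hardy_disc_inner (\<lambda>z. z * e z - c * \<theta> z) (\<lambda>z. \<theta> z * g z) = 0" if g: "g \<in> hardy_disc" for g
  proof -
    let ?b = "\<lambda>z. \<theta> z * backward_shift g z"
    have g': "(\<lambda>z. \<theta> z * g z) \<in> hardy_disc" by (rule isometric_multiplier_mult_in[OF assms(1) g])
    have b: "?b \<in> hardy_disc"
      by (intro isometric_multiplier_mult_in[OF assms(1)] hardy_disc_backward_shift g)
    \<comment> \<open>Splitting \<open>g\<close> into \<open>g 0\<close> and z times its backward
      shift separates a scalar multiple of \<theta> from an element whose factor z can be cancelled
      against that of \<open>z * e z\<close>.\<close>
    have "hardy_disc_inner (\<lambda>z. z * e z) (\<lambda>z. \<theta> z * g z)
        = hardy_disc_inner (\<lambda>z. z * e z) (\<lambda>z. g 0 * \<theta> z + z * ?b z)"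
    proof (intro hardy_disc_inner_cong refl)
      fix z :: complex assume "z \<in> disc"
      from backward_shift_decomp[OF hardy_disc_holomorphic[OF g] this]
      have "\<theta> z * g z = \<theta> z * (g 0 + z * backward_shift g z)" by (rule arg_cong)
      then show "\<theta> z * g z = g 0 * \<theta> z + z * ?b z" by (simp only: distrib_left mult_ac)
    qed
    also have "\<dots> = cnj (g 0) * c + hardy_disc_inner e ?b"
      using e t b assms(2) by (simp add: c_def hardy_disc_inner_add_right hardy_disc_cmult hardy_disc_shift
          hardy_disc_inner_cmult_right hardy_disc_inner_shift_shift model_space_in)
    also have "hardy_disc_inner e ?b = 0"
      by (intro model_space_perp[OF assms(2)] hardy_disc_backward_shift g)
    finally have 1: "hardy_disc_inner (\<lambda>z. z * e z) (\<lambda>z. \<theta> z * g z) = cnj (g 0) * c" by simp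
    have "hardy_disc_inner \<theta> (\<lambda>z. \<theta> z * g z) = cnj (g 0)"
      using isometric_multiplier_inner[OF assms(1) hardy_disc_const g, of 1] by (simp add: hardy_disc_inner_const_left)
    with 1 show ?thesis
      using e t g' by (simp add: hardy_disc_inner_diff_left hardy_disc_cmult hardy_disc_inner_cmult_left)
  qed
  with hardy_disc_diff[OF e hardy_disc_cmult[OF t]] show ?thesis unfolding model_space_def by blast
qed

text \<open>Pairing z with a function reads off the conjugate of its coefficient of index 1. For the
  product this coefficient has two summands, and the term coming from the subtracted multiple of
  \<psi> cancels the one with the derivative of \<open>g\<close>.\<close>

lemma inner_shift_kernel:
  assumes "isometric_multiplier \<psi>" "isometric_multiplier g"
  shows "hardy_disc_inner (\<lambda>z. z * (1 - cnj (\<psi> 0) * \<psi> z)) (\<lambda>z. \<psi> z * g z)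
      = cnj (taylor_coeff \<psi> 1 * g 0)"
proof -
  note ins = isometric_multiplier_in[OF assms(1)] isometric_multiplier_in[OF assms(2)]
    isometric_multiplier_mult_in[OF assms(1) isometric_multiplier_in[OF assms(2)]]
  have z: "(\<lambda>z. z) \<in> hardy_disc" using hardy_disc_shift[OF hardy_disc_const, of 1] by simp
  have z1: "hardy_disc_inner (\<lambda>z. z) h = cnj (taylor_coeff h 1)" if "h \<in> hardy_disc" for h
    using hardy_disc_inner_shift_left[OF hardy_disc_const that, of 1]
      fun_cong[OF taylor_coeff_backward_shift[OF hardy_disc_holomorphic[OF that]], of 0]
    by (simp add: hardy_disc_inner_const_left)
  have "hardy_disc_inner (\<lambda>z. z * (1 - cnj (\<psi> 0) * \<psi> z)) (\<lambda>z. \<psi> z * g z)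
      = hardy_disc_inner (\<lambda>z. z - cnj (\<psi> 0) * (\<psi> z * z)) (\<lambda>z. \<psi> z * g z)"
    by (simp add: algebra_simps)
  also have "\<dots> = hardy_disc_inner (\<lambda>z. z) (\<lambda>z. \<psi> z * g z)
      - cnj (\<psi> 0) * hardy_disc_inner (\<lambda>z. \<psi> z * z) (\<lambda>z. \<psi> z * g z)"
    using z ins isometric_multiplier_mult_in[OF assms(1) z]
    by (simp add: hardy_disc_inner_diff_left hardy_disc_cmult hardy_disc_inner_cmult_left)
  also have "\<dots> = cnj (taylor_coeff (\<lambda>z. \<psi> z * g z) 1) - cnj (\<psi> 0) * cnj (taylor_coeff g 1)"
    using z ins by (simp add: isometric_multiplier_inner[OF assms(1)] z1)
  also have "\<dots> = cnj (taylor_coeff \<psi> 1 * g 0)"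
    using ins by (simp add: taylor_coeff_mult hardy_disc_holomorphic)
  finally show ?thesis .
qed

section \<open>Blaschke products\<close>

text \<open>The lower bound free of \<open>z\<close> makes the reciprocal bounded on the disc; the
  one free of \<open>a\<close> gives estimates uniform over the zeros.\<close>

lemma blaschke_denominator:
  assumes "a \<in> disc" "z \<in> disc"
  shows "1 - cnj a * z \<noteq> 0" "1 - cmod a \<le> cmod (1 - cnj a * z)" "1 - cmod z \<le> cmod (1 - cnj a * z)"
proof -
  have "1 - cmod a * cmod z \<le> cmod (1 - cnj a * z)"
    using norm_triangle_ineq2[of 1 "cnj a * z"] by (simp add: norm_mult)
  moreover have "cmod a * cmod z \<le> cmod a" "cmod a * cmod z \<le> cmod z" "cmod a < 1"
    using assms by (auto simp: mult_left_le mult_left_le_one_le)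
  ultimately show "1 - cnj a * z \<noteq> 0" "1 - cmod a \<le> cmod (1 - cnj a * z)" "1 - cmod z \<le> cmod (1 - cnj a * z)"
    by auto
qed

lemma blaschke_factor_0: "blaschke_factor a 0 = of_real (cmod a)"
  by (simp add: blaschke_factor_def)

lemma blaschke_factor_norm_le:
  assumes "a \<in> disc" "z \<in> disc"
  shows "cmod (blaschke_factor a z) \<le> 1"
proof (cases "a = 0")
  case False
  have "cmod ((z - a) / (1 - cnj a * z)) < 1"
    using Moebius_function_norm_lt_1[of a z 0] assms by (simp add: Moebius_function_simple)
  then show ?thesis
    using False by (simp add: blaschke_factor_def norm_mult norm_divide norm_minus_commute)
qed (use assms in \<open>simp add: blaschke_factor_def\<close>)

lemma holomorphic_blaschke_factor:
  assumes "a \<in> disc"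
  shows "blaschke_factor a holomorphic_on disc"
  using blaschke_denominator(1)[OF assms] unfolding blaschke_factor_def
  by (cases "a = 0") (auto intro!: holomorphic_intros)

text \<open>For nonzero \<open>a\<close> the difference is -(1 - |a|)(a + |a| z) divided by
  \<open>a * (1 - cnj a * z)\<close>. This exhibits a factor that is summable over the zeros of a
  Blaschke product.\<close>

lemma blaschke_factor_minus_1:
  assumes "a \<in> disc" "z \<in> disc"
  shows "cmod (blaschke_factor a z - 1) \<le> (1 - cmod a) * (2 / (1 - cmod z))"
proof (cases "a = 0")
  case True
  have z: "cmod z < 1" using assms by simp
  have "cmod (z - 1) \<le> 2" using norm_triangle_ineq4[of z 1] z by simp
  also have "2 \<le> 2 / (1 - cmod z)" using z by (simp add: field_simps)
  finally show ?thesis using True by (simp add: blaschke_factor_def)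
next
  case False
  note d = blaschke_denominator[OF assms]
  have z: "cmod z < 1" "cmod a < 1" using assms by auto
  have aa: "cnj a * a = of_real (cmod a) * of_real (cmod a)"
    using complex_norm_square[of a] by (simp add: power2_eq_square mult.commute)
  have "blaschke_factor a z - 1 = (of_real (cmod a) * (a - z) - a * (1 - cnj a * z)) / (a * (1 - cnj a * z))"
    using False d by (simp only: blaschke_factor_def times_divide_times_eq if_False
        diff_divide_distrib[of "of_real (cmod a) * (a - z)" "a * (1 - cnj a * z)"] divide_self mult_eq_0_iff simp_thms)
  also have "of_real (cmod a) * (a - z) - a * (1 - cnj a * z)
      = of_real (cmod a) * (a - z) - a + (cnj a * a) * z" by (simp add: algebra_simps)
  also have "\<dots> = - (of_real (1 - cmod a) * (a + of_real (cmod a) * z))"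
    unfolding aa by (simp add: algebra_simps)
  finally have "cmod (blaschke_factor a z - 1)
      = (1 - cmod a) * (cmod (a + of_real (cmod a) * z) / (cmod a * cmod (1 - cnj a * z)))"
    using z by (simp add: norm_mult norm_divide del: of_real_diff)
  also have "\<dots> \<le> (1 - cmod a) * (2 / (1 - cmod z))"
  proof (intro mult_left_mono)
    have "cmod (a + of_real (cmod a) * z) \<le> cmod a + cmod a * cmod z"
      using norm_triangle_ineq[of a "of_real (cmod a) * z"] by (simp add: norm_mult)
    also have "\<dots> \<le> cmod a * 2" using z by (simp add: mult_left_le)
    finally have "cmod (a + of_real (cmod a) * z) / (cmod a * cmod (1 - cnj a * z))
        \<le> (cmod a * 2) / (cmod a * cmod (1 - cnj a * z))"
      by (rule divide_right_mono) simp
    also have "\<dots> = 2 / cmod (1 - cnj a * z)" using False by simp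
    also have "\<dots> \<le> 2 / (1 - cmod z)" by (rule divide_left_mono) (use d z in auto)
    finally show "cmod (a + of_real (cmod a) * z) / (cmod a * cmod (1 - cnj a * z)) \<le> 2 / (1 - cmod z)" .
  qed (use z in auto)
  finally show ?thesis .
qed

text \<open>For \<open>h \<in> H\<^sup>2\<close> the norms of \<open>(a - z) h\<close> and \<open>(1 - cnj a z) h\<close> agree, because multiplication
  by \<open>z\<close> is isometric; apply this to \<open>h = g / (1 - cnj a z)\<close>.\<close>

lemma isometric_multiplier_blaschke_factor:
  assumes a: "a \<in> disc"
  shows "isometric_multiplier (blaschke_factor a)"
  unfolding isometric_multiplier_def
proof (intro conjI ballI holomorphic_blaschke_factor[OF a])
  show "bounded (blaschke_factor a ` disc)"
    using blaschke_factor_norm_le[OF a] unfolding bounded_iff by blast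
  fix g assume g: "g \<in> hardy_disc"
  show "hardy_disc_sqnorm (\<lambda>z. blaschke_factor a z * g z) = hardy_disc_sqnorm g"
  proof (cases "a = 0")
    case True
    then show ?thesis using hardy_disc_sqnorm_shift[OF g] by (simp add: blaschke_factor_def)
  next
    case False
    note d = blaschke_denominator[OF a]
    define h where "h z = 1 / (1 - cnj a * z) * g z" for z
    have "1 / cmod (1 - cnj a * z) \<le> 1 / (1 - cmod a)" if "z \<in> disc" for z
      by (rule divide_left_mono) (use d(2)[OF that] d(1)[OF that] a in auto)
    then have h: "h \<in> hardy_disc"
      unfolding h_def using d(1)
      by (intro hardy_disc_mult_bounded(1)[where M="1 / (1 - cmod a)"] g)
        (auto intro!: holomorphic_intros simp: norm_divide)
    note zh = hardy_disc_shift[OF h]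
    let ?u = "complex_of_real (cmod a) / a"
    have u: "cmod ?u = 1" using False by (simp add: norm_divide)
    have "hardy_disc_sqnorm (\<lambda>z. blaschke_factor a z * g z) = hardy_disc_sqnorm (\<lambda>z. ?u * (a * h z + (-1) * (z * h z)))"
    proof (rule hardy_disc_sqnorm_cong)
      have "u * ((a - z) * i) * g = u * (a * (1 * i * g) + (-1) * (z * (1 * i * g)))" for u a z i g :: complex
        by (simp add: algebra_simps)
      with False show "blaschke_factor a z * g z = ?u * (a * h z + (-1) * (z * h z))" for z
        by (simp only: if_False blaschke_factor_def h_def divide_inverse)
    qed
    also have "\<dots> = hardy_disc_sqnorm (\<lambda>z. a * h z + (-1) * (z * h z))"
      by (simp only: hardy_disc_sqnorm_cmult[OF hardy_disc_add[OF hardy_disc_cmult[OF h] hardy_disc_cmult[OF zh]]] u one_power2 mult_1)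
    \<comment> \<open>The expansions of the two squared norms differ only in which summand carries
      the factor |a|^2; the cross terms have equal real parts.\<close>
    also have "\<dots> = (cmod a)\<^sup>2 * hardy_disc_sqnorm h + hardy_disc_sqnorm h - 2 * Re (a * hardy_disc_inner h (\<lambda>z. z * h z))"
      using h zh hardy_disc_cmult[OF h, of a]
      by (subst hardy_disc_sqnorm_add[OF hardy_disc_cmult[OF h] hardy_disc_cmult[OF zh]])
        (simp only: hardy_disc_sqnorm_cmult hardy_disc_sqnorm_shift hardy_disc_inner_cmult_left
          hardy_disc_inner_cmult_right, simp)
    also have "\<dots> = hardy_disc_sqnorm (\<lambda>z. h z + (- cnj a) * (z * h z))"
      using h zh
      by (subst hardy_disc_sqnorm_add[OF h hardy_disc_cmult[OF zh]])
        (simp only: hardy_disc_sqnorm_cmult hardy_disc_sqnorm_shift hardy_disc_inner_cmult_left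
          hardy_disc_inner_cmult_right, simp)
    also have "\<dots> = hardy_disc_sqnorm g"
    proof (rule hardy_disc_sqnorm_cong)
      fix z :: complex assume "z \<in> disc"
      have "h z + (- cnj a) * (z * h z) = (1 - cnj a * z) * h z" by (simp add: algebra_simps)
      then show "h z + (- cnj a) * (z * h z) = g z" using d(1)[OF \<open>z \<in> disc\<close>] by (simp add: h_def)
    qed
    finally show ?thesis .
  qed
qed

lemma isometric_multiplier_prod_list:
  "(\<And>\<theta>. \<theta> \<in> set \<theta>s \<Longrightarrow> isometric_multiplier \<theta>) \<Longrightarrow> isometric_multiplier (\<lambda>z. \<Prod>\<theta>\<leftarrow>\<theta>s. \<theta> z)"
  by (induction \<theta>s) (auto intro: isometric_multiplier_const isometric_multiplier_mult)

lemma isometric_multiplier_finite_blaschke: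
  assumes "finite_blaschke_product f"
  shows "isometric_multiplier f"
proof -
  obtain c as where c: "cmod c = 1" "set as \<subseteq> disc"
    and f: "\<And>z. z \<in> disc \<Longrightarrow> f z = c * (\<Prod>a\<leftarrow>as. blaschke_factor a z)"
    using assms unfolding finite_blaschke_product_def by blast
  have "isometric_multiplier (\<lambda>z. c * (\<Prod>\<theta>\<leftarrow>map blaschke_factor as. \<theta> z))"
    using c isometric_multiplier_blaschke_factor
    by (intro isometric_multiplier_mult isometric_multiplier_const isometric_multiplier_prod_list) auto
  then show ?thesis by (rule isometric_multiplier_cong) (use f in \<open>simp add: o_def\<close>)
qed

section \<open>Infinite Blaschke products\<close>

locale blaschke_sequence =
  fixes a :: "nat \<Rightarrow> complex"
  assumes in_disc: "a n \<in> disc"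
    and summable: "summable (\<lambda>n. 1 - cmod (a n))"
begin

text \<open>Whatever the locale proves about \<open>B\<close> thereby also applies to the remainder
  products \<open>R\<close>.\<close>

lemma tail: "blaschke_sequence (\<lambda>n. a (n + N))"
  using in_disc summable by unfold_locales (use summable_iff_shift[of "\<lambda>n. 1 - cmod (a n)" N] in auto)

definition B :: "complex \<Rightarrow> complex" where "B z = (\<Prod>n. blaschke_factor (a n) z)"

lemma convergent:
  assumes "z \<in> disc"
  shows "convergent_prod (\<lambda>n. blaschke_factor (a n) z)"
proof (rule abs_convergent_prod_imp_convergent_prod, rule summable_imp_abs_convergent_prod,
    rule summable_comparison_test')
  show "summable (\<lambda>n. (1 - cmod (a n)) * (2 / (1 - cmod z)))" by (intro summable_mult2 summable)
  show "norm (cmod (blaschke_factor (a n) z - 1)) \<le> (1 - cmod (a n)) * (2 / (1 - cmod z))" for n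
    using blaschke_factor_minus_1[OF in_disc assms] by simp
qed

lemma limit:
  assumes "z \<in> disc"
  shows "(\<lambda>N. \<Prod>n<N. blaschke_factor (a n) z) \<longlonglongrightarrow> B z"
  unfolding B_def using convergent_prod_LIMSEQ[OF convergent[OF assms]] LIMSEQ_lessThan_iff_atMost by blast

text \<open>On a smaller closed disc the bound of \<open>blaschke_factor_minus_1\<close> has a
  summable majorant independent of z. Locally uniform convergence is what gives holomorphy of
  \<open>B\<close>.\<close>

lemma uniform_limit:
  assumes "r < 1"
  shows "uniform_limit (cball 0 r) (\<lambda>N z. \<Prod>n<N. blaschke_factor (a n) z) B sequentially"
proof -
  have sub: "cball 0 r \<subseteq> disc" using assms by auto
  have "uniformly_convergent_on (cball 0 r) (\<lambda>N z. \<Prod>n<N. blaschke_factor (a n) z)"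
  proof (rule uniformly_convergent_on_prod')
    show "continuous_on (cball 0 r) (blaschke_factor (a n))" for n
      using holomorphic_on_imp_continuous_on[OF holomorphic_blaschke_factor[OF in_disc]] sub continuous_on_subset by blast
    show "uniformly_convergent_on (cball 0 r) (\<lambda>N z. \<Sum>n<N. norm (blaschke_factor (a n) z - 1))"
    proof (rule Weierstrass_m_test')
      show "summable (\<lambda>n. (1 - cmod (a n)) * (2 / (1 - r)))" by (intro summable_mult2 summable)
      fix n z assume z: "z \<in> cball (0::complex) r"
      have "cmod (blaschke_factor (a n) z - 1) \<le> (1 - cmod (a n)) * (2 / (1 - cmod z))"
        using sub z in_disc by (intro blaschke_factor_minus_1) auto
      also have "\<dots> \<le> (1 - cmod (a n)) * (2 / (1 - r))"
        using in_disc[of n] z assms by (intro mult_left_mono divide_left_mono) auto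
      finally show "norm (norm (blaschke_factor (a n) z - 1)) \<le> (1 - cmod (a n)) * (2 / (1 - r))" by simp
    qed
  qed simp
  then obtain l where l: "uniform_limit (cball 0 r) (\<lambda>N z. \<Prod>n<N. blaschke_factor (a n) z) l sequentially"
    unfolding uniformly_convergent_on_def by blast
  have "l z = B z" if "z \<in> cball 0 r" for z
    using tendsto_uniform_limitI[OF l that] limit[of z] that sub LIMSEQ_unique by blast
  with l show ?thesis by (intro uniform_limit_cong'[THEN iffD1, rotated 2, OF l]) auto
qed

lemma holomorphic: "B holomorphic_on disc"
proof (rule holomorphic_uniform_sequence[where f="\<lambda>N z. \<Prod>n<N. blaschke_factor (a n) z"])
  show "(\<lambda>z. \<Prod>n<N. blaschke_factor (a n) z) holomorphic_on disc" for N
    by (intro holomorphic_intros holomorphic_blaschke_factor in_disc)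
  fix x :: complex assume x: "x \<in> disc"
  \<comment> \<open>Half the distance to the unit circle keeps the ball around \<open>x\<close>
    inside a concentric disc of radius below 1.\<close>
  let ?d = "(1 - cmod x) / 2"
  have sub: "cball x ?d \<subseteq> cball 0 ((1 + cmod x) / 2)"
  proof
    fix y assume "y \<in> cball x ?d"
    then have "cmod (y - x) \<le> ?d" by (simp add: dist_norm norm_minus_commute)
    moreover have "cmod y \<le> cmod x + cmod (y - x)" using norm_triangle_sub[of y x] .
    ultimately show "y \<in> cball 0 ((1 + cmod x) / 2)" by (simp add: field_simps)
  qed
  show "\<exists>d>0. cball x d \<subseteq> disc \<and> uniform_limit (cball x d) (\<lambda>N z. \<Prod>n<N. blaschke_factor (a n) z) B sequentially"
  proof (intro exI conjI)
    show "0 < ?d" using x by simp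
    have "cball 0 ((1 + cmod x) / 2) \<subseteq> disc" using x by auto
    with sub show "cball x ?d \<subseteq> disc" by blast
    show "uniform_limit (cball x ?d) (\<lambda>N z. \<Prod>n<N. blaschke_factor (a n) z) B sequentially"
      by (rule uniform_limit_on_subset[OF uniform_limit sub]) (use x in simp)
  qed
qed simp

lemma norm_le: "z \<in> disc \<Longrightarrow> cmod (B z) \<le> 1"
proof (rule Lim_norm_ubound)
  assume "z \<in> disc"
  then show "(\<lambda>N. \<Prod>n<N. blaschke_factor (a n) z) \<longlonglongrightarrow> B z" by (rule limit)
  show "eventually (\<lambda>N. norm (\<Prod>n<N. blaschke_factor (a n) z) \<le> 1) sequentially"
    using blaschke_factor_norm_le[OF in_disc \<open>z \<in> disc\<close>]
    by (intro always_eventually allI) (auto simp: prod_norm[symmetric] intro!: prod_le_1)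
qed simp

definition R :: "nat \<Rightarrow> complex \<Rightarrow> complex" where "R N = blaschke_sequence.B (\<lambda>n. a (n + N))"

lemma R_props: "R N holomorphic_on disc" "z \<in> disc \<Longrightarrow> cmod (R N z) \<le> 1"
  unfolding R_def using blaschke_sequence.holomorphic[OF tail] blaschke_sequence.norm_le[OF tail] by auto

lemma split:
  assumes "z \<in> disc"
  shows "B z = (\<Prod>n<N. blaschke_factor (a n) z) * R N z"
  using has_prod_unique[OF has_prod_ignore_initial_segment'[OF convergent[OF assms], of N]]
  unfolding B_def R_def blaschke_sequence.B_def[OF tail] by simp

text \<open>Finitely many zeros may sit at the origin and make \<open>B 0\<close> vanish. Beyond an
  index \<open>M\<close> all factors are nonzero at 0, the tail product there is nonzero, and its
  remainders are quotients of it by its own partial products.\<close>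

lemma R_0: "(\<lambda>N. R N 0) \<longlonglongrightarrow> 1"
proof -
  have "(\<lambda>n. 1 - (1 - cmod (a n))) \<longlonglongrightarrow> 1 - 0"
    by (intro tendsto_intros summable_LIMSEQ_zero summable)
  then have "eventually (\<lambda>n. 0 < cmod (a n)) sequentially"
    by (intro order_tendstoD) auto
  then obtain M where M: "\<And>n. n \<ge> M \<Longrightarrow> a n \<noteq> 0" unfolding eventually_sequentially by auto
  interpret T: blaschke_sequence "\<lambda>n. a (n + M)" by (rule tail)
  have nz: "blaschke_factor (a (n + M)) 0 \<noteq> 0" for n using M by (simp add: blaschke_factor_0)
  have P: "T.B 0 \<noteq> 0"
    unfolding T.B_def by (rule prodinf_nonzero[OF T.convergent nz]) simp
  have "T.R k 0 = T.B 0 / (\<Prod>n<k. blaschke_factor (a (n + M)) 0)" for k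
    using T.split[of 0 k] nz by (simp add: field_simps)
  moreover have "(\<lambda>k. T.B 0 / (\<Prod>n<k. blaschke_factor (a (n + M)) 0)) \<longlonglongrightarrow> T.B 0 / T.B 0"
    by (intro tendsto_intros T.limit P) simp
  ultimately have "(\<lambda>k. T.R k 0) \<longlonglongrightarrow> 1" using P by simp
  moreover have "T.R k = R (k + M)" for k
    unfolding T.R_def R_def by (simp add: add.assoc)
  ultimately show ?thesis by (simp add: LIMSEQ_offset)
qed

text \<open>\<open>R N\<close> is bounded by 1, so the squared moduli of its coefficients sum to at
  most 1. As the coefficient of index 0 tends to 1, every other one is squeezed to 0.\<close>

lemma taylor_coeff_R: "(\<lambda>N. taylor_coeff (R N) i) \<longlonglongrightarrow> (if i = 0 then 1 else 0)"
proof (cases "i = 0")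
  case False
  have "(cmod (taylor_coeff (R N) i))\<^sup>2 \<le> 1 - (cmod (R N 0))\<^sup>2" for N
  proof -
    have R: "R N \<in> hardy_disc" "hardy_disc_sqnorm (R N) \<le> 1"
      using hardy_disc_mult_bounded[OF R_props hardy_disc_const, of N 1] by (simp_all add: hardy_disc_sqnorm_const)
    then show ?thesis using hardy_disc_coeff_le_sqnorm[OF R(1), of "{0, i}"] False by simp
  qed
  note le = this
  have "(\<lambda>N. 1 - (cmod (R N 0))\<^sup>2) \<longlonglongrightarrow> 1 - (cmod 1)\<^sup>2" by (intro tendsto_intros R_0)
  then have lim: "(\<lambda>N. 1 - (cmod (R N 0))\<^sup>2) \<longlonglongrightarrow> 0" by simp
  have "(\<lambda>N. (cmod (taylor_coeff (R N) i))\<^sup>2) \<longlonglongrightarrow> 0"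
    by (rule tendsto_sandwich[OF _ _ tendsto_const lim]) (use le in auto)
  then have "(\<lambda>N. sqrt ((cmod (taylor_coeff (R N) i))\<^sup>2)) \<longlonglongrightarrow> sqrt 0" by (intro tendsto_intros)
  with False show ?thesis by (simp add: tendsto_norm_zero_iff)
qed (simp add: R_0)

text \<open>Finite products are isometric, so \<open>B\<close> times \<open>g\<close> and
  \<open>R N\<close> times \<open>g\<close> have the same norm for every \<open>N\<close>. The
  coefficients of the latter converge to those of \<open>g\<close>, so the norm cannot drop; it
  cannot grow because \<open>B\<close> is bounded by 1.\<close>

lemma isometric: "isometric_multiplier B"
  unfolding isometric_multiplier_def
proof (intro conjI ballI holomorphic)
  show "bounded (B ` disc)" using norm_le unfolding bounded_iff by blast
  fix g assume g: "g \<in> hardy_disc"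
  have R: "(\<lambda>z. R N z * g z) \<in> hardy_disc" for N
    using hardy_disc_mult_bounded(1)[OF R_props g] .
  have BR: "hardy_disc_sqnorm (\<lambda>z. B z * g z) = hardy_disc_sqnorm (\<lambda>z. R N z * g z)" for N
  proof -
    have iso: "isometric_multiplier (\<lambda>z. \<Prod>\<theta>\<leftarrow>map (\<lambda>n. blaschke_factor (a n)) [0..<N]. \<theta> z)"
      by (rule isometric_multiplier_prod_list) (auto intro: isometric_multiplier_blaschke_factor in_disc)
    have eq: "(\<Prod>\<theta>\<leftarrow>map (\<lambda>n. blaschke_factor (a n)) [0..<N]. \<theta> z) = (\<Prod>n<N. blaschke_factor (a n) z)" for z
      by (simp add: o_def prod.list_conv_set_nth atLeast0LessThan)
    have "hardy_disc_sqnorm (\<lambda>z. B z * g z)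
        = hardy_disc_sqnorm (\<lambda>z. (\<Prod>n<N. blaschke_factor (a n) z) * (R N z * g z))"
      by (rule hardy_disc_sqnorm_cong) (use split in auto)
    also have "\<dots> = hardy_disc_sqnorm (\<lambda>z. R N z * g z)"
    proof -
      have "\<forall>h\<in>hardy_disc. hardy_disc_sqnorm (\<lambda>z. (\<Prod>n<N. blaschke_factor (a n) z) * h z) = hardy_disc_sqnorm h"
        using iso unfolding eq isometric_multiplier_def by blast
      from bspec[OF this R] show ?thesis .
    qed
    finally show ?thesis .
  qed
  show "hardy_disc_sqnorm (\<lambda>z. B z * g z) = hardy_disc_sqnorm g"
  proof (rule antisym)
    show "hardy_disc_sqnorm (\<lambda>z. B z * g z) \<le> hardy_disc_sqnorm g"
      using hardy_disc_mult_bounded(2)[OF holomorphic norm_le g] by simp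
    have "(\<Sum>k<K. (cmod (taylor_coeff g k))\<^sup>2) \<le> hardy_disc_sqnorm (\<lambda>z. B z * g z)" for K
    proof (rule LIMSEQ_le_const2)
      have "(\<lambda>N. taylor_coeff (\<lambda>z. R N z * g z) k) \<longlonglongrightarrow> taylor_coeff g k" for k
      proof -
        \<comment> \<open>Each coefficient of the product is a finite sum, so the limit in
          \<open>N\<close> may be taken termwise.\<close>
        have "(\<lambda>N. \<Sum>i\<le>k. taylor_coeff (R N) i * taylor_coeff g (k - i))
            \<longlonglongrightarrow> (\<Sum>i\<le>k. (if i = 0 then 1 else 0) * taylor_coeff g (k - i))"
          by (intro tendsto_intros taylor_coeff_R)
        also have "(\<Sum>i\<le>k. (if i = 0 then 1 else 0) * taylor_coeff g (k - i))
            = (\<Sum>i\<le>k. if i = 0 then taylor_coeff g (k - i) else 0)"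
          by (rule sum.cong) auto
        also have "\<dots> = taylor_coeff g k" by (simp add: sum.delta)
        finally show ?thesis
          by (simp only: taylor_coeff_mult[OF R_props(1) hardy_disc_holomorphic[OF g]])
      qed
      then show "(\<lambda>N. \<Sum>k<K. (cmod (taylor_coeff (\<lambda>z. R N z * g z) k))\<^sup>2) \<longlonglongrightarrow> (\<Sum>k<K. (cmod (taylor_coeff g k))\<^sup>2)"
        by (intro tendsto_intros)
      show "\<exists>N. \<forall>n\<ge>N. (\<Sum>k<K. (cmod (taylor_coeff (\<lambda>z. R n z * g z) k))\<^sup>2) \<le> hardy_disc_sqnorm (\<lambda>z. B z * g z)"
      proof (intro exI[of _ 0] allI impI)
        fix n
        show "(\<Sum>k<K. (cmod (taylor_coeff (\<lambda>z. R n z * g z) k))\<^sup>2) \<le> hardy_disc_sqnorm (\<lambda>z. B z * g z)"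
          unfolding BR[of n] by (rule hardy_disc_coeff_le_sqnorm[OF R])
      qed
    qed
    then show "hardy_disc_sqnorm g \<le> hardy_disc_sqnorm (\<lambda>z. B z * g z)"
      unfolding hardy_disc_sqnorm_def[of g] by (intro suminf_le_const hardy_disc_summable g)
  qed
qed

end

lemma isometric_multiplier_blaschke:
  assumes "blaschke_product f"
  shows "isometric_multiplier f"
  using assms unfolding blaschke_product_def
proof
  assume "infinite_blaschke_product f"
  then obtain c a where c: "cmod c = 1" "range a \<subseteq> disc" "summable (\<lambda>n. 1 - cmod (a n))"
    and f: "\<And>z. z \<in> disc \<Longrightarrow> f z = c * (\<Prod>n. blaschke_factor (a n) z)"
    unfolding infinite_blaschke_product_def by blast
  interpret blaschke_sequence a by unfold_locales (use c in \<open>auto simp: image_subset_iff\<close>)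
  have "isometric_multiplier (\<lambda>z. c * B z)"
    by (intro isometric_multiplier_mult isometric_multiplier_const c isometric)
  then show ?thesis by (rule isometric_multiplier_cong) (use f in \<open>simp add: B_def\<close>)
qed (rule isometric_multiplier_finite_blaschke)

text \<open>The quotient is prescribed only where \<open>g\<close> does not vanish. That set is open
  and nonempty because \<open>g\<close> has norm 1, so analytic continuation extends the product
  identity to the whole disc, and \<open>g\<close> can then be cancelled.\<close>

lemma nonconstant_inner_quotient_multiplier:
  assumes "nonconstant_inner_quotient f g" "isometric_multiplier f" "isometric_multiplier g"
  obtains \<theta> where "isometric_multiplier \<theta>" "\<not> \<theta> constant_on disc" "\<And>z. z \<in> disc \<Longrightarrow> f z = g z * \<theta> z"
proof -
  obtain \<theta> where inner: "inner_function \<theta>" and nc: "\<not> \<theta> constant_on disc"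
    and q: "\<And>z. z \<in> disc \<Longrightarrow> g z \<noteq> 0 \<Longrightarrow> \<theta> z = f z / g z"
    using assms(1) unfolding nonconstant_inner_quotient_def by blast
  have h: "\<theta> holomorphic_on disc" "bounded (\<theta> ` disc)" using inner by (auto simp: inner_function_def)
  note hg = isometric_multiplier_holomorphic[OF assms(3)] and hf = isometric_multiplier_holomorphic[OF assms(2)]
  have ne: "{z \<in> disc. g z \<noteq> 0} \<noteq> {}"
  proof
    assume "{z \<in> disc. g z \<noteq> 0} = {}"
    then have "hardy_disc_sqnorm g = hardy_disc_sqnorm (\<lambda>_. 0)"
      by (intro hardy_disc_sqnorm_cong) auto
    then show False by (simp add: isometric_multiplier_sqnorm[OF assms(3)] hardy_disc_sqnorm_const)
  qed
  have op: "open {z \<in> disc. g z \<noteq> 0}"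
  proof -
    have "{z \<in> disc. g z \<noteq> 0} = disc \<inter> g -` (- {0})" by auto
    then show ?thesis
      using continuous_open_preimage[OF holomorphic_on_imp_continuous_on[OF hg] open_ball open_Compl[OF closed_singleton]]
      by simp
  qed
  have eq: "f z = g z * \<theta> z" if "z \<in> disc" for z
    by (rule analytic_continuation_open[OF op open_ball ne _ _ hf _ _ that])
      (auto intro!: holomorphic_intros hg h simp: q)
  have "isometric_multiplier (\<lambda>z. g z * \<theta> z)"
    by (rule isometric_multiplier_cong[OF assms(2)]) (use eq in auto)
  from isometric_multiplier_divide[OF assms(3) h this] nc eq show ?thesis by (rule that)
qed

section \<open>The Hilbert space structure of the Hardy space of the bidisc\<close>

text \<open>The bidisc series are unordered sums. The absolute convergence needed for them comes
  from convergence at a larger radius.\<close>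

lemma taylor_coeff_has_sum:
  assumes f: "f holomorphic_on disc" and z: "z \<in> disc"
  shows "((\<lambda>n. taylor_coeff f n * z ^ n) has_sum f z) UNIV"
proof (rule norm_summable_imp_has_sum)
  show "(\<lambda>n. taylor_coeff f n * z ^ n) sums f z" by (rule taylor_coeff_sums[OF f z])
  obtain r where r: "cmod z < r" "r < 1" using z dense[of "cmod z" 1] by auto
  then have "0 < r" using norm_ge_zero[of z] by linarith
  with r have "summable (\<lambda>n. taylor_coeff f n * of_real r ^ n)"
    using taylor_coeff_sums[OF f, of "of_real r"] by (auto simp: sums_iff)
  from powser_insidea[OF this, of z] r show "summable (\<lambda>n. cmod (taylor_coeff f n * z ^ n))" by simp
qed

lemma hardy_disc_summable_on:
  "f \<in> hardy_disc \<Longrightarrow> (\<lambda>n. (cmod (taylor_coeff f n))\<^sup>2) summable_on UNIV"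
  by (intro summable_nonneg_imp_summable_on hardy_disc_summable) auto

lemma hardy_disc_inner_has_sum:
  assumes "f \<in> hardy_disc" "g \<in> hardy_disc"
  shows "((\<lambda>n. taylor_coeff f n * cnj (taylor_coeff g n)) has_sum hardy_disc_inner f g) UNIV"
proof -
  have *: "((\<lambda>n. taylor_coeff f n * cnj (taylor_coeff g n)) has_sum
      (\<Sum>\<^sub>\<infinity>n. taylor_coeff f n * cnj (taylor_coeff g n))) UNIV"
    by (intro has_sum_infsum summable_on_cmod2_mult hardy_disc_summable_on assms)
  show ?thesis
    using * sums_unique2[OF has_sum_imp_sums[OF *] hardy_disc_inner_sums[OF assms]] by simp
qed

lemma hardy2_coeff_minus: "hardy2_coeff (F - G) = (\<lambda>k. hardy2_coeff F k - hardy2_coeff G k)"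
  using hardy2_coeff_add[of F "scaleC (-1) G"] hardy2_coeff_scaleC[of "-1" G] scaleR_hardy2_eq[of "-1" G]
  by simp

lemma hardy2_eqI:
  assumes "hardy2_coeff F = hardy2_coeff G"
  shows "F = G"
  using hardy2_coeff_eq_zero[of "F - G"] assms by (simp add: hardy2_coeff_minus)

text \<open>The sum is a product of geometric series in the squared moduli of the coordinates. The
  conjugation matches the form of \<open>summable_on_cmod2_mult\<close>.\<close>

lemma summable_on_geometric_bidisc:
  assumes "z \<in> bidisc"
  shows "(\<lambda>k. (cmod (cnj (fst z ^ fst k * snd z ^ snd k)))\<^sup>2) summable_on UNIV"
proof -
  define p q where "p = (cmod (fst z))\<^sup>2" and "q = (cmod (snd z))\<^sup>2"
  have pq: "0 \<le> p" "p < 1" "0 \<le> q" "q < 1"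
    using assms by (auto simp: p_def q_def bidisc_def power_less_one_iff)
  have geo: "((\<lambda>n. x ^ n) has_sum (1 / (1 - x))) UNIV" if "0 \<le> x" "x < 1" for x :: real
    using geometric_sums[of x] that by (intro norm_summable_imp_has_sum) auto
  have "(\<lambda>(i, j). p ^ i * q ^ j) summable_on (SIGMA i:UNIV. UNIV)"
  proof (rule summable_on_SigmaI)
    show "((\<lambda>j. case (i, j) of (i, j) \<Rightarrow> p ^ i * q ^ j) has_sum (p ^ i * (1 / (1 - q)))) UNIV" for i
      by (simp only: prod.case) (intro has_sum_cmult_right geo pq)
    show "(\<lambda>i. p ^ i * (1 / (1 - q))) summable_on UNIV"
      by (intro summable_on_cmult_left has_sum_imp_summable[OF geo] pq)
  qed (use pq in auto)
  then show ?thesis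
    by (simp add: case_prod_unfold p_def q_def norm_mult norm_power power_mult_distrib power_mult[symmetric] mult.commute)
qed

text \<open>Square-summable arrays converge pointwise against the geometric weights. This lets
  limits, shifts and tensors be constructed from their coefficients.\<close>

lemma hardy2_of_coeff:
  assumes "(\<lambda>k. (cmod (a k))\<^sup>2) summable_on UNIV"
  obtains F where "hardy2_coeff F = a"
proof -
  \<comment> \<open>The value 0 off the bidisc is the normalisation built into the type.\<close>
  define f where "f z = (if z \<in> bidisc then \<Sum>\<^sub>\<infinity>k. a k * (fst z ^ fst k * snd z ^ snd k) else 0)" for z
  have "((\<lambda>k. a k * (fst z ^ fst k * snd z ^ snd k)) has_sum f z) UNIV" if "z \<in> bidisc" for z
    using has_sum_infsum[OF summable_on_cmod2_mult[OF assms summable_on_geometric_bidisc[OF that]]] that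
    by (simp add: f_def)
  with assms have hs: "hardy_series a f" by (simp add: hardy_series_def)
  then have "hardy2_fun (Abs_hardy2 f) = f" by (intro Abs_hardy2_inverse) (auto simp: f_def)
  with hs have "hardy2_coeff (Abs_hardy2 f) = a" by (intro hardy2_coeff_eqI) simp
  then show ?thesis by (rule that)
qed

lemma cinner_has_sum:
  "((\<lambda>k. hardy2_coeff F k * cnj (hardy2_coeff G k)) has_sum cinner F G) UNIV"
  unfolding cinner_def by (rule has_sum_infsum[OF cinner_summable])

lemma cinner_diff_left: "cinner (F - G) H = cinner F H - cinner G H"
  using cinner_add_left[of "F - G" G H] by simp

lemma cinner_scaleC_right: "cinner F (scaleC c G) = cnj c * cinner F G"
  by (subst (1 2) cinner_commute) (simp add: cinner_scaleC_left)

lemma Re_cinner_self: "Re (cinner F F) = (norm F)\<^sup>2"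
  by (simp add: power2_norm_eq_inner inner_hardy2_def)

lemma norm_hardy2_sq: "(norm F)\<^sup>2 = (\<Sum>\<^sub>\<infinity>k. (cmod (hardy2_coeff F k))\<^sup>2)"
  unfolding Re_cinner_self[symmetric] cinner_self by simp

lemma norm_scaleC: "norm (scaleC c F) = cmod c * norm F"
proof -
  have "(norm (scaleC c F))\<^sup>2 = (cmod c * norm F)\<^sup>2"
    unfolding power_mult_distrib norm_hardy2_sq hardy2_coeff_scaleC norm_mult
    by (rule infsum_cmult_right')
  then show ?thesis by (simp add: power2_eq_iff_nonneg)
qed

text \<open>The completeness argument of l^2: coefficients converge one by one, and the limit array
  is shown to be square-summable and close in norm.\<close>

lemma hardy2_Cauchy_convergent:
  fixes X :: "nat \<Rightarrow> hardy2"
  assumes "Cauchy X"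
  shows "convergent X"
proof -
  define c where "c n = hardy2_coeff (X n)" for n
  have fin: "(\<Sum>k\<in>A. (cmod (c m k - c n k))\<^sup>2) \<le> (norm (X m - X n))\<^sup>2" if "finite A" for A m n
    unfolding norm_hardy2_sq hardy2_coeff_minus c_def
    by (rule finite_sum_le_infsum[OF _ that])
      (use hardy2_coeff_square_summable[of "X m - X n"] in \<open>auto simp: hardy2_coeff_minus\<close>)
  have coeff: "cmod (c m k - c n k) \<le> norm (X m - X n)" for m n k
    using fin[of "{k}" m n] by (simp add: power2_le_iff_abs_le)
  have "convergent (\<lambda>n. c n k)" for k
  proof (rule Cauchy_convergent, rule metric_CauchyI)
    fix e :: real assume "0 < e"
    from metric_CauchyD[OF assms this] obtain N where "\<forall>m\<ge>N. \<forall>n\<ge>N. dist (X m) (X n) < e" by blast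
    then show "\<exists>N. \<forall>m\<ge>N. \<forall>n\<ge>N. dist (c m k) (c n k) < e"
      using coeff unfolding dist_norm by (meson order_le_less_trans)
  qed
  then obtain a where a: "\<And>k. (\<lambda>n. c n k) \<longlonglongrightarrow> a k"
    unfolding convergent_def by metis
  \<comment> \<open>The Cauchy bound is uniform over finite index sets, so \<open>n\<close> may go
    to infinity before the sets exhaust all indices.\<close>
  have ev: "\<exists>N. \<forall>m\<ge>N. \<forall>A. finite A \<longrightarrow> (\<Sum>k\<in>A. (cmod (c m k - a k))\<^sup>2) \<le> e\<^sup>2" if "0 < e" for e
  proof -
    from metric_CauchyD[OF assms that] obtain N where N: "\<And>m n. m \<ge> N \<Longrightarrow> n \<ge> N \<Longrightarrow> dist (X m) (X n) < e"
      by blast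
    have "(\<Sum>k\<in>A. (cmod (c m k - a k))\<^sup>2) \<le> e\<^sup>2" if "m \<ge> N" "finite A" for m A
    proof (rule LIMSEQ_le_const2)
      show "(\<lambda>n. \<Sum>k\<in>A. (cmod (c m k - c n k))\<^sup>2) \<longlonglongrightarrow> (\<Sum>k\<in>A. (cmod (c m k - a k))\<^sup>2)"
        by (intro tendsto_intros a)
      have "(\<Sum>k\<in>A. (cmod (c m k - c n k))\<^sup>2) \<le> e\<^sup>2" if "n \<ge> N" for n
        using fin[OF \<open>finite A\<close>, of m n] power_mono[of "norm (X m - X n)" e 2] N[OF \<open>m \<ge> N\<close> that]
        by (simp add: dist_norm)
      then show "\<exists>N. \<forall>n\<ge>N. (\<Sum>k\<in>A. (cmod (c m k - c n k))\<^sup>2) \<le> e\<^sup>2" by blast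
    qed
    then show ?thesis by blast
  qed
  have diff: "(\<lambda>k. (cmod (c m k - a k))\<^sup>2) summable_on UNIV"
    if "\<And>A. finite A \<Longrightarrow> (\<Sum>k\<in>A. (cmod (c m k - a k))\<^sup>2) \<le> e\<^sup>2" for m e
    by (rule nonneg_bdd_above_summable_on) (use that in \<open>auto intro!: bdd_aboveI[of _ "e\<^sup>2"]\<close>)
  \<comment> \<open>Square-summability of \<open>a\<close> follows from that of
    \<open>c M - a\<close> and of \<open>c M\<close>; the difference produces \<open>- a\<close>,
    which has the same moduli.\<close>
  from ev[of 1] obtain M where "\<And>A. finite A \<Longrightarrow> (\<Sum>k\<in>A. (cmod (c M k - a k))\<^sup>2) \<le> 1\<^sup>2" by auto
  from summable_on_cmod2_add[OF diff[OF this] hardy2_coeff_square_summable[of "scaleC (-1) (X M)"]]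
  have "(\<lambda>k. (cmod (- a k))\<^sup>2) summable_on UNIV" unfolding hardy2_coeff_scaleC c_def by simp
  then obtain F where F: "hardy2_coeff F = a" by (auto intro: hardy2_of_coeff)
  have "X \<longlonglongrightarrow> F"
  proof (rule metric_LIMSEQ_I)
    fix e :: real assume e: "0 < e"
    with ev[of "e / 2"] obtain N where N: "\<And>m A. m \<ge> N \<Longrightarrow> finite A \<Longrightarrow> (\<Sum>k\<in>A. (cmod (c m k - a k))\<^sup>2) \<le> (e / 2)\<^sup>2"
      by auto
    have "dist (X m) F < e" if "m \<ge> N" for m
    proof -
      have "(norm (X m - F))\<^sup>2 \<le> (e / 2)\<^sup>2"
        unfolding norm_hardy2_sq hardy2_coeff_minus F c_def[symmetric]
        using diff[of m "e / 2"] N[OF that] by (intro infsum_le_finite_sums) auto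
      then have "norm (X m - F) \<le> e / 2" using e by (simp add: power2_le_iff_abs_le)
      then show ?thesis using e by (simp add: dist_norm)
    qed
    then show "\<exists>N. \<forall>m\<ge>N. dist (X m) F < e" by blast
  qed
  then show ?thesis unfolding convergent_def by blast
qed

section \<open>Closed complex subspaces and orthogonal projection\<close>

definition closed_csubspace :: "hardy2 set \<Rightarrow> bool" where
  "closed_csubspace Q \<longleftrightarrow> closed Q \<and> hardy2.subspace Q"

lemma csubspace_scaleR: "hardy2.subspace Q \<Longrightarrow> F \<in> Q \<Longrightarrow> r *\<^sub>R F \<in> Q"
  unfolding scaleR_hardy2_eq by (rule hardy2.subspace_scale)

text \<open>A minimising sequence converges to a closest point, and closeness implies orthogonality.
  Minimality is kept in the conclusion because later any explicit element of \<open>Q\<close> serves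
  as an upper bound for the distance.\<close>

lemma csubspace_projection_exists:
  assumes "closed_csubspace Q"
  obtains G where "G \<in> Q" "\<And>H. H \<in> Q \<Longrightarrow> cinner (F - G) H = 0" "\<And>H. H \<in> Q \<Longrightarrow> norm (F - G) \<le> norm (F - H)"
proof -
  have cl: "closed Q" and sub: "hardy2.subspace Q" using assms by (auto simp: closed_csubspace_def)
  have ne: "Q \<noteq> {}" using hardy2.subspace_0[OF sub] by blast
  define d where "d = infdist F Q"
  have d: "d \<le> norm (F - H)" if "H \<in> Q" for H
    using infdist_le[OF that, of F] by (simp add: d_def dist_norm)
  have d0: "0 \<le> d" by (simp add: d_def infdist_nonneg)
  have "\<exists>H\<in>Q. norm (F - H) < d + 1 / Suc n" for n
  proof -
    have "(INF H\<in>Q. dist F H) < d + 1 / Suc n" using ne by (simp add: d_def infdist_def)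
    then show ?thesis by (subst (asm) cINF_less_iff) (auto simp: ne dist_norm intro!: bdd_belowI[of _ 0])
  qed
  then obtain X where XQ: "\<And>n. X n \<in> Q" and X: "\<And>n. norm (F - X n) < d + 1 / Suc n" by metis
  \<comment> \<open>Parallelogram law: the midpoint lies in \<open>Q\<close>, so its distance from
    \<open>F\<close> is at least \<open>d\<close>, which forces terms of nearly minimal distance
    close together.\<close>
  have par: "(norm (X m - X n))\<^sup>2 \<le> 2 * ((norm (F - X m))\<^sup>2 - d\<^sup>2) + 2 * ((norm (F - X n))\<^sup>2 - d\<^sup>2)" for m n
  proof -
    have "(1/2) *\<^sub>R (X m + X n) \<in> Q"
      by (intro csubspace_scaleR[OF sub] hardy2.subspace_add[OF sub] XQ)
    from d[OF this] d0 have "d\<^sup>2 \<le> (norm (F - (1/2) *\<^sub>R (X m + X n)))\<^sup>2" by (intro power_mono)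
    also have "4 * (norm (F - (1/2) *\<^sub>R (X m + X n)))\<^sup>2
        = 2 * (norm (F - X m))\<^sup>2 + 2 * (norm (F - X n))\<^sup>2 - (norm (X m - X n))\<^sup>2"
      by (simp add: power2_norm_eq_inner inner_simps inner_commute algebra_simps)
    finally show ?thesis by simp
  qed
  have lim: "(\<lambda>n. 2 * ((d + 1 / real (Suc n))\<^sup>2 - d\<^sup>2)) \<longlonglongrightarrow> 0"
  proof -
    have "(\<lambda>n. 2 * ((d + 1 / real (Suc n))\<^sup>2 - d\<^sup>2)) \<longlonglongrightarrow> 2 * ((d + 0)\<^sup>2 - d\<^sup>2)"
      by (intro tendsto_intros LIMSEQ_Suc[OF lim_1_over_n])
    then show ?thesis by simp
  qed
  have "Cauchy X"
  proof (rule metric_CauchyI)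
    fix e :: real assume e: "0 < e"
    then have "0 < e\<^sup>2 / 2" by simp
    from order_tendstoD(2)[OF lim this] obtain N
      where N: "\<And>n. n \<ge> N \<Longrightarrow> 2 * ((d + 1 / real (Suc n))\<^sup>2 - d\<^sup>2) < e\<^sup>2 / 2"
      unfolding eventually_sequentially by blast
    have "dist (X m) (X n) < e" if "m \<ge> N" "n \<ge> N" for m n
    proof -
      have "(norm (F - X k))\<^sup>2 \<le> (d + 1 / real (Suc k))\<^sup>2" for k
        using X[of k] by (intro power_mono) auto
      then have "(norm (X m - X n))\<^sup>2 < e\<^sup>2"
        using par[of m n] N[OF that(1)] N[OF that(2)] by (smt (verit) field_sum_of_halves)
      then show ?thesis using e by (simp add: dist_norm power2_less_imp_less)
    qed
    then show "\<exists>N. \<forall>m\<ge>N. \<forall>n\<ge>N. dist (X m) (X n) < e" by blast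
  qed
  then obtain G where G: "X \<longlonglongrightarrow> G" using hardy2_Cauchy_convergent by (auto simp: convergent_def)
  have GQ: "G \<in> Q" using closed_sequentially[OF cl _ G] XQ by blast
  have "norm (F - G) \<le> d"
  proof (rule LIMSEQ_le)
    show "(\<lambda>n. norm (F - X n)) \<longlonglongrightarrow> norm (F - G)" by (intro tendsto_intros G)
    have "(\<lambda>n. d + 1 / real (Suc n)) \<longlonglongrightarrow> d + 0" by (intro tendsto_intros LIMSEQ_Suc[OF lim_1_over_n])
    then show "(\<lambda>n. d + 1 / real (Suc n)) \<longlonglongrightarrow> d" by simp
    show "\<exists>N. \<forall>n\<ge>N. norm (F - X n) \<le> d + 1 / real (Suc n)" using X less_imp_le by blast
  qed
  with d have min: "norm (F - G) \<le> norm (F - H)" if "H \<in> Q" for H using that order_trans by blast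
  have conv: "convex Q"
    using csubspace_scaleR[OF sub] hardy2.subspace_add[OF sub] by (auto simp: convex_def)
  \<comment> \<open>The closest-point inequality is taken at \<open>G + H\<close>; applying the
    result to the negative of \<open>H\<close> then gives equality.\<close>
  have le: "inner (F - G) H \<le> 0" if "H \<in> Q" for H
    using any_closest_point_dot[OF conv cl GQ hardy2.subspace_add[OF sub GQ that], of F] min
    by (simp add: dist_norm)
  have eq: "Re (cinner (F - G) H) = 0" if "H \<in> Q" for H
    using le[OF that] le[OF csubspace_scaleR[OF sub that, of "-1"]] by (simp add: inner_hardy2_def[symmetric])
  \<comment> \<open>The imaginary part is the real part at \<i> times \<open>H\<close>; this uses
    that \<open>Q\<close> is a complex subspace.\<close>
  have "cinner (F - G) H = 0" if "H \<in> Q" for H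
    using eq[OF that] eq[OF hardy2.subspace_scale[OF sub that], of \<i>]
    by (simp add: cinner_scaleC_right complex_eq_iff)
  with GQ min show ?thesis by (blast intro: that)
qed

text \<open>Supplies uniqueness for both definite descriptions, \<open>hardy2_proj\<close> and
  \<open>adjoint_on\<close>.\<close>

lemma csubspace_orthogonal_unique:
  assumes "hardy2.subspace Q" "G \<in> Q" "G' \<in> Q" "\<And>H. H \<in> Q \<Longrightarrow> cinner H G = cinner H G'"
  shows "G = G'"
proof -
  have "cinner (G - G') (G - G') = 0"
    using assms(4)[OF hardy2.subspace_diff[OF assms(1-3)]]
    by (subst cinner_commute, subst cinner_diff_left, subst (1 2) cinner_commute) simp
  then have "(norm (G - G'))\<^sup>2 = 0" unfolding Re_cinner_self[symmetric] by simp
  then show ?thesis by simp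
qed

lemma hardy2_proj:
  assumes Q: "closed_csubspace Q"
  shows "hardy2_proj Q F \<in> Q" "H \<in> Q \<Longrightarrow> cinner (F - hardy2_proj Q F) H = 0"
    "H \<in> Q \<Longrightarrow> norm (F - hardy2_proj Q F) \<le> norm (F - H)"
proof -
  obtain G where G: "G \<in> Q" "\<And>H. H \<in> Q \<Longrightarrow> cinner (F - G) H = 0" "\<And>H. H \<in> Q \<Longrightarrow> norm (F - G) \<le> norm (F - H)"
    using csubspace_projection_exists[OF Q] by blast
  have "hardy2_proj Q F = G"
    unfolding hardy2_proj_def
  proof (rule the_equality)
    fix G' assume G': "G' \<in> Q \<and> (\<forall>H\<in>Q. cinner (F - G') H = 0)"
    have "cinner H G' = cinner H G" if "H \<in> Q" for H
      using G(2)[OF that] bspec[OF conjunct2[OF G'] that] cinner_commute[of H G] cinner_commute[of H G']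
      by (simp add: cinner_diff_left)
    then show "G' = G"
      using csubspace_orthogonal_unique[of Q G' G] G' G(1) Q unfolding closed_csubspace_def by blast
  qed (use G in blast)
  with G show "hardy2_proj Q F \<in> Q" "H \<in> Q \<Longrightarrow> cinner (F - hardy2_proj Q F) H = 0"
    "H \<in> Q \<Longrightarrow> norm (F - hardy2_proj Q F) \<le> norm (F - H)" by auto
qed

lemma csubspace_closure:
  assumes sub: "hardy2.subspace S"
  shows "closed_csubspace (closure S)"
  unfolding closed_csubspace_def
proof (intro conjI hardy2.subspaceI closed_closure)
  show "0 \<in> closure S" using hardy2.subspace_0[OF sub] closure_subset by blast
  fix F G assume F: "F \<in> closure S" and G: "G \<in> closure S"
  then obtain X Y where X: "\<And>n. X n \<in> S" "X \<longlonglongrightarrow> F" and Y: "\<And>n. Y n \<in> S" "Y \<longlonglongrightarrow> G"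
    unfolding closure_sequential by blast
  have "(\<lambda>n. X n + Y n) \<longlonglongrightarrow> F + G" by (intro tendsto_intros X Y)
  moreover have "X n + Y n \<in> S" for n by (intro hardy2.subspace_add[OF sub] X Y)
  ultimately show "F + G \<in> closure S" unfolding closure_sequential by (intro exI[of _ "\<lambda>n. X n + Y n"]) auto
next
  fix c F assume "F \<in> closure S"
  then obtain X where X: "\<And>n. X n \<in> S" "X \<longlonglongrightarrow> F" unfolding closure_sequential by blast
  have "(\<lambda>n. cmod c * norm (X n - F)) \<longlonglongrightarrow> cmod c * 0"
    by (intro tendsto_intros tendsto_norm_zero X(2)[THEN Lim_null[THEN iffD1]])
  then have "(\<lambda>n. norm (scaleC c (X n) - scaleC c F)) \<longlonglongrightarrow> 0"
    by (simp add: norm_scaleC hardy2.scale_right_diff_distrib[symmetric])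
  then have "(\<lambda>n. scaleC c (X n)) \<longlonglongrightarrow> scaleC c F"
    unfolding tendsto_norm_zero_iff by (rule Lim_null[THEN iffD2])
  moreover have "scaleC c (X n) \<in> S" for n by (intro hardy2.subspace_scale[OF sub] X)
  ultimately show "scaleC c F \<in> closure S" unfolding closure_sequential by (intro exI[of _ "\<lambda>n. scaleC c (X n)"]) auto
qed

section \<open>The backward shift in the first variable\<close>

lemma hardy2_coeff_mult_fst:
  "hardy2_coeff (mult_op fst F) (i, j) = (if i = 0 then 0 else hardy2_coeff F (i - 1, j))"
proof -
  define s :: "nat \<times> nat \<Rightarrow> nat \<times> nat" where "s = (\<lambda>(m, n). (Suc m, n))"
  have s: "inj s" by (auto simp: s_def inj_on_def)
  have "hardy_series (\<lambda>k. if k \<in> range s then hardy2_coeff F (inv s k) else 0) (\<lambda>z. fst z * hardy2_fun F z)"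
    by (rule hardy_series_shift[OF hardy_series_coeff s]) (auto simp: s_def)
  then have c: "hardy2_coeff (mult_op fst F) = (\<lambda>k. if k \<in> range s then hardy2_coeff F (inv s k) else 0)"
    by (intro hardy2_coeff_eqI) (simp add: hardy2_fun_mult_op)
  show ?thesis
  proof (cases i)
    case (Suc m)
    have "(i, j) = s (m, j)" by (simp add: s_def Suc)
    then show ?thesis using s by (simp add: c Suc)
  next
    case 0
    have "(0, j) \<notin> range s" by (auto simp: s_def)
    then show ?thesis using 0 by (simp add: c)
  qed
qed

text \<open>The choice is determined: coefficients fix an element by \<open>hardy2_eqI\<close>, and
  a witness is built in the lemma that follows.\<close>

definition backward_shift_fst :: "hardy2 \<Rightarrow> hardy2" where
  "backward_shift_fst F = (SOME G. \<forall>i j. hardy2_coeff G (i, j) = hardy2_coeff F (Suc i, j))"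

lemma hardy2_coeff_backward_shift_fst:
  "hardy2_coeff (backward_shift_fst F) (i, j) = hardy2_coeff F (Suc i, j)"
proof -
  define s :: "nat \<times> nat \<Rightarrow> nat \<times> nat" where "s = (\<lambda>(m, n). (Suc m, n))"
  have s: "inj s" by (auto simp: s_def inj_on_def)
  have "(\<lambda>k. (cmod (hardy2_coeff F k))\<^sup>2) summable_on range s"
    using hardy2_coeff_square_summable by (rule summable_on_subset_banach) simp
  then have "(\<lambda>k. (cmod (hardy2_coeff F (s k)))\<^sup>2) summable_on UNIV"
    by (subst (asm) summable_on_reindex[OF s]) (simp add: o_def)
  then obtain G where "hardy2_coeff G = (\<lambda>k. hardy2_coeff F (s k))" by (rule hardy2_of_coeff)
  then have "\<exists>G. \<forall>i j. hardy2_coeff G (i, j) = hardy2_coeff F (Suc i, j)"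
    by (intro exI[of _ G]) (simp add: s_def)
  from someI_ex[OF this] show ?thesis unfolding backward_shift_fst_def by blast
qed

text \<open>The coefficients of \<open>mult_op fst F\<close> vanish off the range of the index
  shift, so the sum reindexes to one over all indices.\<close>

lemma cinner_mult_fst_left: "cinner (mult_op fst F) G = cinner F (backward_shift_fst G)"
proof -
  define s :: "nat \<times> nat \<Rightarrow> nat \<times> nat" where "s = (\<lambda>(m, n). (Suc m, n))"
  have s: "inj s" by (auto simp: s_def inj_on_def)
  have b: "hardy2_coeff (backward_shift_fst G) k = hardy2_coeff G (Suc (fst k), snd k)" for k
    by (cases k) (simp add: hardy2_coeff_backward_shift_fst)
  have "((\<lambda>k. hardy2_coeff (mult_op fst F) k * cnj (hardy2_coeff G k)) has_sum cinner F (backward_shift_fst G)) (range s)"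
  proof (subst has_sum_reindex[OF s])
    show "((\<lambda>k. hardy2_coeff (mult_op fst F) k * cnj (hardy2_coeff G k)) \<circ> s has_sum cinner F (backward_shift_fst G)) UNIV"
      using cinner_has_sum[of F "backward_shift_fst G"]
      by (simp add: o_def s_def case_prod_unfold hardy2_coeff_mult_fst b)
  qed
  then have "((\<lambda>k. hardy2_coeff (mult_op fst F) k * cnj (hardy2_coeff G k)) has_sum cinner F (backward_shift_fst G)) UNIV"
  proof (rule has_sum_cong_neutral[THEN iffD1, rotated -1])
    fix k assume "k \<in> UNIV - range s"
    then have "fst k = 0" by (cases k; cases "fst k") (auto simp: s_def image_def)
    then show "hardy2_coeff (mult_op fst F) k * cnj (hardy2_coeff G k) = 0"
      by (cases k) (simp add: hardy2_coeff_mult_fst)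
  qed auto
  from has_sum_unique[OF cinner_has_sum this] show ?thesis .
qed

lemma backward_shift_fst_mult_fst: "backward_shift_fst (mult_op fst F) = F"
  by (rule hardy2_eqI) (auto simp: hardy2_coeff_backward_shift_fst hardy2_coeff_mult_fst)

lemma norm_mult_fst: "norm (mult_op fst F) = norm F"
proof -
  have "(norm (mult_op fst F))\<^sup>2 = (norm F)\<^sup>2"
    unfolding Re_cinner_self[symmetric] cinner_mult_fst_left backward_shift_fst_mult_fst ..
  then show ?thesis by (simp add: power2_eq_iff_nonneg)
qed

lemma backward_shift_fst_add: "backward_shift_fst (F + G) = backward_shift_fst F + backward_shift_fst G"
  by (rule hardy2_eqI) (auto simp: hardy2_coeff_backward_shift_fst hardy2_coeff_add)

lemma backward_shift_fst_scaleC: "backward_shift_fst (scaleC c F) = scaleC c (backward_shift_fst F)"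
  by (rule hardy2_eqI) (auto simp: hardy2_coeff_backward_shift_fst hardy2_coeff_scaleC)

text \<open>The adjoint of an isometry is a contraction, by Cauchy--Schwarz.\<close>

lemma norm_backward_shift_fst_le: "norm (backward_shift_fst F) \<le> norm F"
proof -
  let ?B = "backward_shift_fst F"
  have "norm ?B * norm ?B = inner (mult_op fst ?B) F"
    using Re_cinner_self[of ?B] by (simp add: inner_hardy2_def cinner_mult_fst_left power2_eq_square)
  also have "\<dots> \<le> norm ?B * norm F"
    using norm_cauchy_schwarz[of "mult_op fst ?B" F] by (simp add: norm_mult_fst)
  finally show ?thesis using mult_le_cancel_left[of "norm ?B"] by (cases "?B = 0") auto
qed

lemma bounded_linear_backward_shift_fst: "bounded_linear backward_shift_fst"
proof (rule bounded_linear_intro[of _ 1])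
  show "backward_shift_fst (r *\<^sub>R F) = r *\<^sub>R backward_shift_fst F" for r F
    unfolding scaleR_hardy2_eq by (rule backward_shift_fst_scaleC)
qed (auto simp: backward_shift_fst_add norm_backward_shift_fst_le)

text \<open>Linearity carries the assumption to the span and continuity to its closure. It serves
  both closures in the definition of the Rudin module: that of each tensor product and that of their
  union.\<close>

lemma backward_shift_fst_closure_span:
  assumes "\<And>F. F \<in> S \<Longrightarrow> backward_shift_fst F \<in> closure (hardy2_span T)"
    and "F \<in> closure (hardy2_span S)"
  shows "backward_shift_fst F \<in> closure (hardy2_span T)"
proof -
  have T: "hardy2.subspace (closure (hardy2_span T))"
    using csubspace_closure[OF hardy2.subspace_span] by (simp add: closed_csubspace_def)
  have "backward_shift_fst F \<in> closure (hardy2_span T)" if "F \<in> hardy2_span S" for F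
    using that
  proof (induction rule: hardy2.span_induct_alt)
    case base
    then show ?case
      using hardy2.subspace_0[OF T] linear_0[OF bounded_linear.linear[OF bounded_linear_backward_shift_fst]] by simp
  next
    case (step c x y)
    then show ?case
      using hardy2.subspace_add[OF T hardy2.subspace_scale[OF T assms(1)]]
      by (simp add: backward_shift_fst_add backward_shift_fst_scaleC)
  qed
  then have "backward_shift_fst ` closure (hardy2_span S) \<subseteq> closure (hardy2_span T)"
    by (intro image_closure_subset linear_continuous_on[OF bounded_linear_backward_shift_fst]) auto
  then show ?thesis using assms(2) by blast
qed

section \<open>Elementary tensors\<close>

text \<open>Prescribing coefficients makes inner products factor at once; the description as a
  product of function values is \<open>hardy2_fun_tensor\<close>.\<close>

definition tensor :: "(complex \<Rightarrow> complex) \<Rightarrow> (complex \<Rightarrow> complex) \<Rightarrow> hardy2" where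
  "tensor f g = (SOME F. \<forall>i j. hardy2_coeff F (i, j) = taylor_coeff f i * taylor_coeff g j)"

lemma hardy2_coeff_tensor:
  assumes "f \<in> hardy_disc" "g \<in> hardy_disc"
  shows "hardy2_coeff (tensor f g) (i, j) = taylor_coeff f i * taylor_coeff g j"
proof -
  have "(\<lambda>(i, j). (cmod (taylor_coeff f i))\<^sup>2 * (cmod (taylor_coeff g j))\<^sup>2) summable_on (SIGMA i:UNIV. UNIV)"
  proof (rule summable_on_SigmaI)
    show "((\<lambda>j. case (i, j) of (i, j) \<Rightarrow> (cmod (taylor_coeff f i))\<^sup>2 * (cmod (taylor_coeff g j))\<^sup>2) has_sum
        ((cmod (taylor_coeff f i))\<^sup>2 * (\<Sum>\<^sub>\<infinity>j. (cmod (taylor_coeff g j))\<^sup>2))) UNIV" for i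
      by (simp only: prod.case) (intro has_sum_cmult_right has_sum_infsum hardy_disc_summable_on assms)
    show "(\<lambda>i. (cmod (taylor_coeff f i))\<^sup>2 * (\<Sum>\<^sub>\<infinity>j. (cmod (taylor_coeff g j))\<^sup>2)) summable_on UNIV"
      by (intro summable_on_cmult_left hardy_disc_summable_on assms)
  qed auto
  then have "(\<lambda>k. (cmod (case k of (i, j) \<Rightarrow> taylor_coeff f i * taylor_coeff g j))\<^sup>2) summable_on UNIV"
    by (simp add: case_prod_unfold norm_mult power_mult_distrib)
  then obtain F where "hardy2_coeff F = (\<lambda>(i, j). taylor_coeff f i * taylor_coeff g j)"
    by (rule hardy2_of_coeff)
  then have "\<exists>F. \<forall>i j. hardy2_coeff F (i, j) = taylor_coeff f i * taylor_coeff g j"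
    by (intro exI[of _ F]) simp
  from someI_ex[OF this] show ?thesis unfolding tensor_def by blast
qed

text \<open>Iterated summation of an unordered double sum. It yields both the factorisation of inner
  products and that of point values.\<close>

lemma has_sum_product_split:
  fixes a b :: "nat \<Rightarrow> complex"
  assumes "((\<lambda>(i, j). a i * b j) has_sum s) UNIV" "(a has_sum x) UNIV" "(b has_sum y) UNIV"
  shows "s = x * y"
proof -
  have "((\<lambda>i. a i * y) has_sum s) UNIV"
  proof (rule has_sum_SigmaD)
    show "((\<lambda>(i, j). a i * b j) has_sum s) (SIGMA i:UNIV. UNIV)" using assms(1) by simp
    show "((\<lambda>j. case (i, j) of (i, j) \<Rightarrow> a i * b j) has_sum a i * y) UNIV" for i
      using has_sum_cmult_right[OF assms(3)] by simp
  qed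
  from has_sum_unique[OF this has_sum_cmult_left[OF assms(2)]] show ?thesis .
qed

lemma cinner_tensor:
  assumes "f \<in> hardy_disc" "g \<in> hardy_disc" "f' \<in> hardy_disc" "g' \<in> hardy_disc"
  shows "cinner (tensor f g) (tensor f' g') = hardy_disc_inner f f' * hardy_disc_inner g g'"
proof (rule has_sum_product_split)
  show "((\<lambda>(i, j). (taylor_coeff f i * cnj (taylor_coeff f' i)) * (taylor_coeff g j * cnj (taylor_coeff g' j)))
      has_sum cinner (tensor f g) (tensor f' g')) UNIV"
    using cinner_has_sum[of "tensor f g" "tensor f' g'"]
    by (rule has_sum_cong[THEN iffD1, rotated]) (auto simp: hardy2_coeff_tensor assms)
qed (intro hardy_disc_inner_has_sum assms)+

lemma norm_tensor_sq:
  assumes "f \<in> hardy_disc" "g \<in> hardy_disc"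
  shows "(norm (tensor f g))\<^sup>2 = hardy_disc_sqnorm f * hardy_disc_sqnorm g"
  unfolding Re_cinner_self[symmetric] by (simp add: cinner_tensor assms hardy_disc_inner_self)

lemma hardy2_fun_tensor:
  assumes "f \<in> hardy_disc" "g \<in> hardy_disc" "z \<in> disc" "w \<in> disc"
  shows "hardy2_fun (tensor f g) (z, w) = f z * g w"
proof (rule has_sum_product_split)
  have "((\<lambda>k. hardy2_coeff (tensor f g) k * (z ^ fst k * w ^ snd k)) has_sum hardy2_fun (tensor f g) (z, w)) UNIV"
    using hardy_series_coeff[of "tensor f g"] assms(3,4) by (auto simp: hardy_series_def bidisc_def)
  then show "((\<lambda>(i, j). (taylor_coeff f i * z ^ i) * (taylor_coeff g j * w ^ j))
      has_sum hardy2_fun (tensor f g) (z, w)) UNIV"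
    by (rule has_sum_cong[THEN iffD1, rotated]) (auto simp: hardy2_coeff_tensor assms)
qed (intro taylor_coeff_has_sum hardy_disc_holomorphic assms)+

lemma hardy2_fun_eqI:
  assumes "\<And>z w. z \<in> disc \<Longrightarrow> w \<in> disc \<Longrightarrow> hardy2_fun F (z, w) = hardy2_fun G (z, w)"
  shows "F = G"
proof -
  have "hardy2_fun F p = hardy2_fun G p" for p
  proof (cases "p \<in> bidisc")
    case True
    then show ?thesis using assms by (cases p) (auto simp: bidisc_def)
  next
    case False
    then have "hardy2_fun H p = 0" for H using hardy2_fun[of H] by blast
    then show ?thesis by simp
  qed
  then show ?thesis by (simp add: hardy2_fun_inject[symmetric] fun_eq_iff)
qed

text \<open>An element is determined by its values on the bidisc, so the generators in the
  definition are exactly the elementary tensors.\<close>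

lemma hardy_tensor_altdef:
  assumes "A \<subseteq> hardy_disc" "B \<subseteq> hardy_disc"
  shows "hardy_tensor A B = closure (hardy2_span {tensor f g | f g. f \<in> A \<and> g \<in> B})"
proof -
  have "{F. \<exists>f\<in>A. \<exists>g\<in>B. \<forall>z\<in>disc. \<forall>w\<in>disc. hardy2_fun F (z, w) = f z * g w} = {tensor f g | f g. f \<in> A \<and> g \<in> B}"
    (is "?L = ?R")
  proof (intro set_eqI iffI)
    fix F assume "F \<in> ?L"
    then obtain f g where fg: "f \<in> A" "g \<in> B" and F: "\<forall>z\<in>disc. \<forall>w\<in>disc. hardy2_fun F (z, w) = f z * g w"
      by blast
    have "F = tensor f g"
      by (rule hardy2_fun_eqI) (use fg F assms in \<open>simp add: hardy2_fun_tensor subset_iff\<close>)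
    with fg show "F \<in> ?R" by blast
  next
    fix F assume "F \<in> ?R"
    then obtain f g where F: "F = tensor f g" and fg: "f \<in> A" "g \<in> B" by blast
    then have "\<forall>z\<in>disc. \<forall>w\<in>disc. hardy2_fun F (z, w) = f z * g w"
      using assms by (auto intro!: hardy2_fun_tensor)
    with fg show "F \<in> ?L" by blast
  qed
  then show ?thesis by (simp add: hardy_tensor_def)
qed

lemma mult_fst_tensor:
  assumes "f \<in> hardy_disc" "g \<in> hardy_disc"
  shows "mult_op fst (tensor f g) = tensor (\<lambda>z. z * f z) g"
  by (rule hardy2_eqI)
    (auto simp: hardy2_coeff_mult_fst hardy2_coeff_tensor assms hardy_disc_shift taylor_coeff_shift hardy_disc_holomorphic)

lemma backward_shift_fst_tensor:
  assumes "f \<in> hardy_disc" "g \<in> hardy_disc"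
  shows "backward_shift_fst (tensor f g) = tensor (backward_shift f) g"
  by (rule hardy2_eqI)
    (auto simp: hardy2_coeff_backward_shift_fst hardy2_coeff_tensor assms hardy_disc_backward_shift
      taylor_coeff_backward_shift hardy_disc_holomorphic)

lemma tensor_diff_scale_left:
  assumes "f \<in> hardy_disc" "g \<in> hardy_disc" "h \<in> hardy_disc"
  shows "tensor (\<lambda>z. f z - c * g z) h = tensor f h - scaleC c (tensor g h)"
proof -
  have "taylor_coeff (\<lambda>z. f z - c * g z) n = taylor_coeff f n - c * taylor_coeff g n" for n
  proof -
    have h: "f holomorphic_on disc" "g holomorphic_on disc"
      using assms by (auto intro: hardy_disc_holomorphic)
    have "(\<lambda>z. - c * g z) holomorphic_on disc" by (intro holomorphic_intros h)
    then show ?thesis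
      using taylor_coeff_add[OF h(1), of "\<lambda>z. - c * g z"] unfolding taylor_coeff_cmult[OF h(2)] by simp
  qed
  then show ?thesis
    by (intro hardy2_eqI ext)
      (auto simp: hardy2_coeff_minus hardy2_coeff_scaleC hardy2_coeff_tensor assms hardy_disc_diff hardy_disc_cmult left_diff_distrib mult.assoc)
qed

section \<open>The self-commutator of the compressed shift\<close>

lemma cinner_compression:
  assumes "closed_csubspace Q" "H \<in> Q"
  shows "cinner (compression Q p F) H = cinner (mult_op p F) H"
  using hardy2_proj(2)[OF assms, of "mult_op p F"] by (simp add: compression_def cinner_diff_left)

text \<open>Against elements of \<open>Q\<close> the projection in the compression disappears, and
  invariance keeps the adjoint shift inside \<open>Q\<close>.\<close>

lemma adjoint_compression_fst:
  assumes Q: "closed_csubspace Q" and inv: "backward_shift_fst ` Q \<subseteq> Q" and F: "F \<in> Q"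
  shows "adjoint_on Q (compression Q fst) F = backward_shift_fst F"
  unfolding adjoint_on_def
proof (rule the_equality)
  show *: "backward_shift_fst F \<in> Q \<and> (\<forall>H\<in>Q. cinner (compression Q fst H) F = cinner H (backward_shift_fst F))"
    using inv F by (auto simp: cinner_compression[OF Q F] cinner_mult_fst_left)
  fix G assume "G \<in> Q \<and> (\<forall>H\<in>Q. cinner (compression Q fst H) F = cinner H G)"
  with * show "G = backward_shift_fst F"
    using Q csubspace_orthogonal_unique[of Q G "backward_shift_fst F"] by (simp add: closed_csubspace_def)
qed

text \<open>Written so as to coincide with the operator in \<open>essentially_normal\<close> for
  \<open>p = q = fst\<close>.\<close>

definition self_commutator_fst :: "hardy2 set \<Rightarrow> hardy2 \<Rightarrow> hardy2" where
  "self_commutator_fst Q F = compression Q fst (adjoint_on Q (compression Q fst) F)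
     - adjoint_on Q (compression Q fst) (compression Q fst F)"

text \<open>The left side is the squared norm of the adjoint at \<open>x\<close> minus that of the
  compression at \<open>x\<close>. By Pythagoras the latter is the squared norm of \<open>x\<close>
  minus the squared distance of \<open>mult_op fst x\<close> from \<open>Q\<close>, and any
  competitor \<open>y\<close> bounds that distance.\<close>

lemma inner_self_commutator_fst_le:
  assumes Q: "closed_csubspace Q" and inv: "backward_shift_fst ` Q \<subseteq> Q"
    and x: "x \<in> Q" and y: "y \<in> Q"
  shows "inner (self_commutator_fst Q x) x
    \<le> (norm (backward_shift_fst x))\<^sup>2 - (norm x)\<^sup>2 + (norm (mult_op fst x - y))\<^sup>2"
proof -
  let ?C = "compression Q fst" and ?M = "mult_op fst" and ?B = "backward_shift_fst"
  have Cx: "?C x \<in> Q" unfolding compression_def by (rule hardy2_proj(1)[OF Q])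
  have "cinner (?C (?B x)) x = cinner (?B x) (?B x)"
    by (simp add: cinner_compression[OF Q x] cinner_mult_fst_left)
  moreover have "cinner (?B (?C x)) x = cnj (cinner (?C x) (?C x))"
    using cinner_commute[of "?B (?C x)" x] cinner_mult_fst_left[of x "?C x"] cinner_compression[OF Q Cx, of fst x]
    by simp
  ultimately have "inner (self_commutator_fst Q x) x = (norm (?B x))\<^sup>2 - (norm (?C x))\<^sup>2"
    unfolding self_commutator_fst_def adjoint_compression_fst[OF Q inv x] adjoint_compression_fst[OF Q inv Cx]
    by (simp add: inner_hardy2_def cinner_diff_left Re_cinner_self)
  moreover have "(norm x)\<^sup>2 = (norm (?C x))\<^sup>2 + (norm (?M x - ?C x))\<^sup>2"
  proof -
    have "inner (?M x - ?C x) (?C x) = 0"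
      using hardy2_proj(2)[OF Q Cx, of "?M x"] by (simp add: inner_hardy2_def compression_def)
    then have "(norm (?C x + (?M x - ?C x)))\<^sup>2 = (norm (?C x))\<^sup>2 + (norm (?M x - ?C x))\<^sup>2"
      unfolding power2_norm_eq_inner inner_add_left inner_add_right by (simp add: inner_commute)
    then show ?thesis by (simp add: norm_mult_fst)
  qed
  moreover have "(norm (?M x - ?C x))\<^sup>2 \<le> (norm (?M x - y))\<^sup>2"
    unfolding compression_def by (intro power_mono hardy2_proj(3)[OF Q y]) simp
  ultimately show ?thesis by linarith
qed

text \<open>Bessel's inequality: subtracting the components of \<open>y\<close> one at a time shows
  that their squares are summable.\<close>

lemma orthonormal_weakly_null:
  fixes x :: "nat \<Rightarrow> 'a::real_inner"
  assumes norm: "\<And>n. norm (x n) = 1" and orth: "\<And>m n. m < n \<Longrightarrow> inner (x m) (x n) = 0"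
  shows "(\<lambda>n. inner y (x n)) \<longlonglongrightarrow> 0"
proof -
  define p where "p N = (\<Sum>n<N. inner y (x n) *\<^sub>R x n)" for N
  have "(norm (y - p N))\<^sup>2 = (norm y)\<^sup>2 - (\<Sum>n<N. (inner y (x n))\<^sup>2)" for N
  proof (induction N)
    case 0
    then show ?case by (simp add: p_def)
  next
    case (Suc N)
    have 1: "inner (y - p N) (x N) = inner y (x N)"
      by (simp add: p_def inner_diff_left inner_sum_left orth)
    have "(norm (y - p (Suc N)))\<^sup>2 = (norm ((y - p N) - inner y (x N) *\<^sub>R x N))\<^sup>2"
      by (simp add: p_def algebra_simps)
    also have "\<dots> = (norm (y - p N))\<^sup>2 - 2 * (inner y (x N) * inner (y - p N) (x N)) + (inner y (x N))\<^sup>2 * (norm (x N))\<^sup>2"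
      unfolding power2_norm_eq_inner inner_diff_left[of "y - p N"] inner_diff_right[of _ "y - p N"]
      by (simp add: inner_commute power2_eq_square)
    finally show ?case using Suc 1 norm by (simp add: power2_eq_square)
  qed
  then have "(\<Sum>n<N. (inner y (x n))\<^sup>2) \<le> (norm y)\<^sup>2" for N
    using zero_le_power2[of "norm (y - p N)"] by simp
  then have "summable (\<lambda>n. (inner y (x n))\<^sup>2)" by (intro summableI_nonneg_bounded) auto
  from tendsto_real_sqrt[OF summable_LIMSEQ_zero[OF this]] show ?thesis by (simp add: tendsto_rabs_zero_iff)
qed

text \<open>Compactness gives a subsequence along which the images converge to some
  \<open>l\<close>. Pairing with \<open>x\<close> costs nothing in norm, and \<open>l\<close> pairs
  to 0 in the limit by weak nullity, so the quadratic form would tend to 0.\<close>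

lemma not_compact_operator_on:
  fixes x :: "nat \<Rightarrow> hardy2"
  assumes xQ: "\<And>n. x n \<in> Q" and norm: "\<And>n. norm (x n) = 1"
    and orth: "\<And>m n. m < n \<Longrightarrow> inner (x m) (x n) = 0"
    and T: "\<And>n. inner (T (x n)) (x n) \<le> - \<delta>" and \<delta>: "0 < \<delta>"
  shows "\<not> compact_operator_on Q T"
proof
  assume "compact_operator_on Q T"
  then have sc: "seq_compact (closure (T ` (Q \<inter> cball 0 1)))"
    by (simp add: compact_operator_on_def compact_imp_seq_compact)
  have "\<forall>n. T (x n) \<in> closure (T ` (Q \<inter> cball 0 1))"
    using xQ norm by (intro allI closure_subset[THEN subsetD] imageI) auto
  from seq_compactE[OF sc this] obtain l r where r: "strict_mono r" and l: "((\<lambda>n. T (x n)) \<circ> r) \<longlonglongrightarrow> l"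
    by blast
  have "(\<lambda>n. norm (T (x (r n)) - l)) \<longlonglongrightarrow> 0"
    using l by (intro tendsto_norm_zero Lim_null[THEN iffD1]) (simp add: o_def)
  then have "(\<lambda>n. inner (T (x (r n)) - l) (x (r n))) \<longlonglongrightarrow> 0"
  proof (rule Lim_null_comparison[OF always_eventually[OF allI], rotated])
    show "norm (inner (T (x (r n)) - l) (x (r n))) \<le> norm (T (x (r n)) - l)" for n
      using Cauchy_Schwarz_ineq2[of "T (x (r n)) - l" "x (r n)"] by (simp add: norm)
  qed
  moreover have "(\<lambda>n. inner l (x n)) \<longlonglongrightarrow> 0"
    by (rule orthonormal_weakly_null) (use norm orth in auto)
  ultimately have "(\<lambda>n. inner (T (x (r n)) - l) (x (r n)) + ((\<lambda>n. inner l (x n)) \<circ> r) n) \<longlonglongrightarrow> 0 + 0"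
    by (intro tendsto_add LIMSEQ_subseq_LIMSEQ[OF _ r])
  then
  have "(\<lambda>n. inner (T (x (r n))) (x (r n))) \<longlonglongrightarrow> 0" by (simp add: o_def inner_diff_left)
  then have "0 \<le> - \<delta>" by (rule LIMSEQ_le_const2) (use T in blast)
  with \<delta> show False by simp
qed

section \<open>Rudin quotient modules\<close>

lemma rudin_quotient_module_closed: "closed_csubspace (rudin_quotient_module \<psi> \<phi>)"
  unfolding rudin_quotient_module_def by (rule csubspace_closure[OF hardy2.subspace_span])

lemma hardy_tensor_subset_rudin:
  "hardy_tensor (model_space (\<psi> n)) (model_space (\<phi> n)) \<subseteq> rudin_quotient_module \<psi> \<phi>"
  unfolding rudin_quotient_module_def using closure_subset hardy2.span_superset by fastforce

lemma hardy_tensor_model_space: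
  "hardy_tensor (model_space \<theta>) (model_space \<eta>)
    = closure (hardy2_span {tensor f g | f g. f \<in> model_space \<theta> \<and> g \<in> model_space \<eta>})"
  by (rule hardy_tensor_altdef) (auto intro: model_space_in)

lemma tensor_in_rudin:
  assumes "f \<in> model_space (\<psi> n)" "g \<in> model_space (\<phi> n)"
  shows "tensor f g \<in> rudin_quotient_module \<psi> \<phi>"
proof -
  have "tensor f g \<in> hardy2_span {tensor f g | f g. f \<in> model_space (\<psi> n) \<and> g \<in> model_space (\<phi> n)}"
    using assms by (intro hardy2.span_base) blast
  then show ?thesis
    using hardy_tensor_subset_rudin[of \<psi> n \<phi>] closure_subset unfolding hardy_tensor_model_space by blast
qed

text \<open>On elementary tensors the shift acts only on the first factor, where the model space is
  invariant.\<close>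

lemma backward_shift_fst_rudin:
  assumes iso: "\<And>n. isometric_multiplier (\<psi> n)" and F: "F \<in> rudin_quotient_module \<psi> \<phi>"
  shows "backward_shift_fst F \<in> rudin_quotient_module \<psi> \<phi>"
proof -
  have "backward_shift_fst G \<in> hardy_tensor (model_space (\<psi> n)) (model_space (\<phi> n))"
    if "G \<in> hardy_tensor (model_space (\<psi> n)) (model_space (\<phi> n))" for n G
    using that unfolding hardy_tensor_model_space
  proof (rule backward_shift_fst_closure_span[rotated])
    let ?S = "{tensor f g | f g. f \<in> model_space (\<psi> n) \<and> g \<in> model_space (\<phi> n)}"
    fix G assume "G \<in> ?S"
    then obtain f g where G: "G = tensor f g" "f \<in> model_space (\<psi> n)" "g \<in> model_space (\<phi> n)" by blast
    then have "backward_shift_fst G = tensor (backward_shift f) g"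
      by (simp add: backward_shift_fst_tensor model_space_in)
    moreover have "tensor (backward_shift f) g \<in> ?S"
      using model_space_backward_shift[OF iso[of n] G(2)] G(3) by blast
    ultimately have "backward_shift_fst G \<in> ?S" by simp
    then show "backward_shift_fst G \<in> closure (hardy2_span ?S)"
      by (intro closure_subset[THEN subsetD] hardy2.span_base)
  qed
  then have "backward_shift_fst G \<in> rudin_quotient_module \<psi> \<phi>"
    if "G \<in> (\<Union>n. hardy_tensor (model_space (\<psi> n)) (model_space (\<phi> n)))" for G
    using that hardy_tensor_subset_rudin[of \<psi> _ \<phi>] by fast
  then show ?thesis
    using F unfolding rudin_quotient_module_def by (rule backward_shift_fst_closure_span)
qed

section \<open>Test functions extracted from the two sequences\<close>

lemma hardy_disc_sqnorm_backward_shift: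
  assumes "f \<in> hardy_disc"
  shows "hardy_disc_sqnorm (backward_shift f) = hardy_disc_sqnorm f - (cmod (f 0))\<^sup>2"
  using suminf_split_head[OF hardy_disc_summable[OF assms]]
  by (simp add: hardy_disc_sqnorm_def taylor_coeff_backward_shift[OF hardy_disc_holomorphic[OF assms]])

lemma model_space_cmult:
  assumes "isometric_multiplier \<theta>" "f \<in> model_space \<theta>"
  shows "(\<lambda>z. c * f z) \<in> model_space \<theta>"
  using assms(2) isometric_multiplier_mult_in[OF assms(1)]
  by (simp add: model_space_def hardy_disc_cmult hardy_disc_inner_cmult_left)

text \<open>The witness is \<open>\<phi>\<^sub>n\<^sub>+\<^sub>1 (1 - cnj (\<theta> 0) \<theta>)\<close> with \<open>\<theta> = \<phi>\<^sub>n / \<phi>\<^sub>n\<^sub>+\<^sub>1\<close>.\<close>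

lemma decreasing_model_space_orthogonal:
  assumes iso: "\<And>n. isometric_multiplier (\<phi> n)" and dec: "decreasing_inner \<phi>"
  obtains f where "\<And>n. f n \<in> model_space (\<phi> n)" "\<And>n. 0 < hardy_disc_sqnorm (f n)"
    "\<And>m n. m < n \<Longrightarrow> hardy_disc_inner (f n) (f m) = 0"
proof -
  have "\<exists>\<theta>. isometric_multiplier \<theta> \<and> \<not> \<theta> constant_on disc \<and> (\<forall>z\<in>disc. \<phi> n z = \<phi> (Suc n) z * \<theta> z)" for n
    using nonconstant_inner_quotient_multiplier[OF _ iso iso] dec unfolding decreasing_inner_def by metis
  then obtain \<theta> where t: "\<And>n. isometric_multiplier (\<theta> n)" "\<And>n. \<not> \<theta> n constant_on disc"
    and eq: "\<And>n z. z \<in> disc \<Longrightarrow> \<phi> n z = \<phi> (Suc n) z * \<theta> n z"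
    by metis
  define k where "k n z = 1 - cnj (\<theta> n 0) * \<theta> n z" for n z
  have k: "k n \<in> model_space (\<theta> n)" for n
    using model_space_kernel(1)[OF t(1)] by (simp add: k_def[abs_def])
  have ms: "model_space (\<phi> n) = model_space (\<lambda>z. \<phi> (Suc n) z * \<theta> n z)" for n
    by (rule model_space_cong) (rule eq)
  have f: "(\<lambda>z. \<phi> (Suc n) z * k n z) \<in> model_space (\<phi> n)" for n
    unfolding ms by (rule model_space_mult[OF iso t(1) k])
  have "model_space (\<phi> (Suc n)) \<subseteq> model_space (\<phi> n)" for n
    using model_space_mono[OF t(1)] unfolding ms[of n] by blast
  then have mono: "model_space (\<phi> n) \<subseteq> model_space (\<phi> m)" if "m \<le> n" for m n
    using lift_Suc_antimono_le[of "\<lambda>n. model_space (\<phi> n)", OF _ that] by blast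
  show ?thesis
  proof (rule that[of "\<lambda>n z. \<phi> (Suc n) z * k n z"])
    have "hardy_disc_sqnorm (\<lambda>z. \<phi> (Suc n) z * k n z) = hardy_disc_sqnorm (k n)" for n
      using iso[of "Suc n"] model_space_in[OF k] unfolding isometric_multiplier_def by blast
    also have "hardy_disc_sqnorm (k n) = 1 - (cmod (\<theta> n 0))\<^sup>2" for n
      using model_space_kernel(2)[OF t(1)] by (simp add: k_def[abs_def])
    finally show "0 < hardy_disc_sqnorm (\<lambda>z. \<phi> (Suc n) z * k n z)" for n
      using isometric_multiplier_norm_0[OF t] by (simp add: power_less_one_iff)
    \<comment> \<open>By nesting, the function of index \<open>n\<close> lies in the model space of
      \<open>\<phi> (Suc m)\<close>, while the one of index \<open>m\<close> is a multiple of
      \<open>\<phi> (Suc m)\<close>.\<close>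
    show "hardy_disc_inner (\<lambda>z. \<phi> (Suc n) z * k n z) (\<lambda>z. \<phi> (Suc m) z * k m z) = 0" if "m < n" for m n
      using f[of n] mono[of "Suc m" n] that by (intro model_space_perp model_space_in[OF k]) auto
  qed (rule f)
qed

text \<open>The constant \<gamma> is the modulus at 0 of the ratio of \<open>\<psi> 2\<close> and
  \<open>\<psi> 1\<close>; later ratios are at most 1 in modulus there, so it works for all
  \<open>n\<close>. The base index is 1 because \<open>\<psi> 0\<close> may be constant, whereas
  \<open>\<psi> 1\<close> contains a nonconstant ratio.\<close>

lemma increasing_inner_factor:
  assumes iso: "\<And>n. isometric_multiplier (\<psi> n)" and inc: "increasing_inner \<psi>"
  obtains \<gamma> where "0 \<le> \<gamma>" "\<gamma> < 1"
    "\<And>n. \<exists>g. isometric_multiplier g \<and> cmod (g 0) \<le> \<gamma> \<and> (\<forall>z\<in>disc. \<psi> (n + 2) z = \<psi> 1 z * g z)"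
    "cmod (\<psi> 1 0) < 1"
proof -
  have "\<exists>\<theta>. isometric_multiplier \<theta> \<and> \<not> \<theta> constant_on disc \<and> (\<forall>z\<in>disc. \<psi> (Suc n) z = \<psi> n z * \<theta> z)" for n
    using nonconstant_inner_quotient_multiplier[OF _ iso iso] inc unfolding increasing_inner_def by metis
  then obtain \<theta> where t: "\<And>n. isometric_multiplier (\<theta> n)" "\<And>n. \<not> \<theta> n constant_on disc"
    and eq: "\<And>n z. z \<in> disc \<Longrightarrow> \<psi> (Suc n) z = \<psi> n z * \<theta> n z"
    by metis
  show ?thesis
  proof (rule that[of "cmod (\<theta> 1 0)"])
    show "cmod (\<theta> 1 0) < 1" by (rule isometric_multiplier_norm_0[OF t])
    show "\<exists>g. isometric_multiplier g \<and> cmod (g 0) \<le> cmod (\<theta> 1 0) \<and> (\<forall>z\<in>disc. \<psi> (n + 2) z = \<psi> 1 z * g z)" for n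
    proof (induction n)
      case 0
      show ?case using t eq[of _ 1] by (intro exI[of _ "\<theta> 1"]) (simp add: numeral_2_eq_2)
    next
      case (Suc n)
      then obtain g where g: "isometric_multiplier g" "cmod (g 0) \<le> cmod (\<theta> 1 0)" "\<And>z. z \<in> disc \<Longrightarrow> \<psi> (n + 2) z = \<psi> 1 z * g z"
        by blast
      have "cmod (g 0 * \<theta> (n + 2) 0) \<le> cmod (\<theta> 1 0) * 1"
        unfolding norm_mult using g(2) isometric_multiplier_norm_0_le[OF t(1)] by (intro mult_mono) auto
      then show ?case
        using isometric_multiplier_mult[OF g(1) t(1)[of "n + 2"]] g(3) eq[of _ "n + 2"]
        by (intro exI[of _ "\<lambda>z. g z * \<theta> (n + 2) z"]) (simp add: mult.assoc)
    qed
    have "cmod (\<psi> 1 0) = cmod (\<psi> 0 0) * cmod (\<theta> 0 0)" using eq[of 0 0] by (simp add: norm_mult)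
    also have "\<dots> \<le> 1 * cmod (\<theta> 0 0)"
      using isometric_multiplier_norm_0_le[OF iso] by (intro mult_right_mono) auto
    also have "\<dots> < 1" using isometric_multiplier_norm_0[OF t] by simp
    finally show "cmod (\<psi> 1 0) < 1" .
  qed simp
qed

theorem theorem3p5:
  fixes \<psi> \<phi> :: "nat \<Rightarrow> complex \<Rightarrow> complex"
  assumes "\<And>n. finite_blaschke_product (\<psi> n)"
    and "increasing_inner \<psi>"
    and "\<And>n. blaschke_product (\<phi> n)"
    and "decreasing_inner \<phi>"
  shows "\<not> essentially_normal (rudin_quotient_module \<psi> \<phi>)"
proof
  let ?Q = "rudin_quotient_module \<psi> \<phi>"
  assume "essentially_normal ?Q"
  then have compact: "compact_operator_on ?Q (self_commutator_fst ?Q)"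
    unfolding essentially_normal_def self_commutator_fst_def[abs_def] by blast
  have iso: "isometric_multiplier (\<psi> n)" for n
    using assms(1) by (rule isometric_multiplier_finite_blaschke)
  have iso': "isometric_multiplier (\<phi> n)" for n
    using assms(3) by (rule isometric_multiplier_blaschke)
  note Q = rudin_quotient_module_closed[of \<psi> \<phi>] 
  have inv: "backward_shift_fst ` ?Q \<subseteq> ?Q" using backward_shift_fst_rudin[of \<psi>, OF iso] by blast
  obtain f where f: "\<And>n. f n \<in> model_space (\<phi> n)" "\<And>n. 0 < hardy_disc_sqnorm (f n)"
    "\<And>m n. m < n \<Longrightarrow> hardy_disc_inner (f n) (f m) = 0"
    using decreasing_model_space_orthogonal[OF iso' assms(4)] by metis
  obtain \<gamma> where \<gamma>: "0 \<le> \<gamma>" "\<gamma> < 1"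
    and fac: "\<And>n. \<exists>g. isometric_multiplier g \<and> cmod (g 0) \<le> \<gamma> \<and> (\<forall>z\<in>disc. \<psi> (n + 2) z = \<psi> 1 z * g z)"
    and \<psi>1: "cmod (\<psi> 1 0) < 1"
    using increasing_inner_factor[OF iso assms(2)] by metis
  define s where "s = 1 - (cmod (\<psi> 1 0))\<^sup>2"
  define e where "e z = 1 - cnj (\<psi> 1 0) * \<psi> 1 z" for z
  have s: "0 < s" using \<psi>1 by (simp add: s_def power_less_one_iff)
  have e1: "e \<in> model_space (\<psi> 1)" and es: "hardy_disc_sqnorm e = s"
    using model_space_kernel[OF iso[of 1]] by (simp_all add: e_def[abs_def] s_def)
  have e0: "e 0 = of_real s"
    using complex_norm_square[of "\<psi> 1 0"] by (simp add: e_def s_def mult.commute)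
  note eH = model_space_in[OF e1]
  \<comment> \<open>The scaling makes the tensor of \<open>e\<close> and \<open>h n\<close> a unit
    vector, as \<open>e\<close> has squared norm \<open>s\<close>. The offset 2 restricts to indices
    whose ratio with \<open>\<psi> 1\<close> is controlled by \<gamma>.\<close>
  define h where "h n z = of_real (1 / sqrt (s * hardy_disc_sqnorm (f (n + 2)))) * f (n + 2) z" for n z
  have h: "h n \<in> model_space (\<phi> (n + 2))" for n
    unfolding h_def by (rule model_space_cmult[OF iso' f(1)])
  have hH: "h n \<in> hardy_disc" for n using model_space_in[OF h] .
  have hs: "hardy_disc_sqnorm (h n) = 1 / s" for n
    using s f(2)[of "n + 2"]
    unfolding h_def hardy_disc_sqnorm_cmult[OF model_space_in[OF f(1)]] norm_of_real power2_abs power_divide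
    by simp
  have ho: "hardy_disc_inner (h m) (h n) = 0" if "n < m" for m n
    using that f(3)[of "n + 2" "m + 2"] model_space_in[OF f(1)]
    unfolding h_def hardy_disc_inner_cmult_left[OF model_space_in[OF f(1)] hardy_disc_cmult[OF model_space_in[OF f(1)]]]
      hardy_disc_inner_cmult_right[OF model_space_in[OF f(1)] model_space_in[OF f(1)]]
    by simp
  define x where "x n = tensor e (h n)" for n
  \<comment> \<open>One first factor serves for all \<open>n\<close>, since the model spaces grow
    with \<psi>.\<close>
  have e: "e \<in> model_space (\<psi> (n + 2))" for n
  proof -
    obtain g where g: "isometric_multiplier g" "\<And>z. z \<in> disc \<Longrightarrow> \<psi> (n + 2) z = \<psi> 1 z * g z" using fac[of n] by blast
    have "model_space (\<psi> (n + 2)) = model_space (\<lambda>z. \<psi> 1 z * g z)" by (rule model_space_cong) (rule g)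
    then show ?thesis using model_space_mono[OF g(1) e1] by simp
  qed
  have xQ: "x n \<in> ?Q" for n unfolding x_def by (rule tensor_in_rudin[where \<psi>=\<psi> and \<phi>=\<phi>, OF e h])
  have x2: "(norm (x n))\<^sup>2 = 1" for n using s by (simp add: x_def norm_tensor_sq eH hH es hs)
  have "inner (self_commutator_fst ?Q (x n)) (x n) \<le> - (s * (1 - \<gamma>\<^sup>2))" for n
  proof -
    let ?\<psi> = "\<psi> (n + 2)"
    define c where "c = hardy_disc_inner (\<lambda>z. z * e z) ?\<psi>"
    \<comment> \<open>An explicit competitor for the projection: only the first factor is corrected,
      inside the tensor block of index \<open>n + 2\<close>.\<close>
    define y where "y = tensor (\<lambda>z. z * e z - c * ?\<psi> z) (h n)"
    note \<psi>H = isometric_multiplier_in[OF iso[of "n + 2"]]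
    have y: "y \<in> ?Q"
      unfolding y_def c_def by (rule tensor_in_rudin[where \<psi>=\<psi> and \<phi>=\<phi>, OF model_space_shift_project[OF iso e] h])
    obtain g where g: "isometric_multiplier g" "cmod (g 0) \<le> \<gamma>" "\<And>z. z \<in> disc \<Longrightarrow> ?\<psi> z = \<psi> 1 z * g z"
      using fac[of n] by blast
    have "c = hardy_disc_inner (\<lambda>z. z * (1 - cnj (\<psi> 1 0) * \<psi> 1 z)) (\<lambda>z. \<psi> 1 z * g z)"
      unfolding c_def by (rule hardy_disc_inner_cong) (simp_all only: e_def g(3))
    also have "\<dots> = cnj (taylor_coeff (\<psi> 1) 1 * g 0)" by (rule inner_shift_kernel[OF iso g(1)])
    finally have "cmod c = cmod (taylor_coeff (\<psi> 1) 1) * cmod (g 0)" by (simp add: norm_mult)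
    also have "\<dots> \<le> s * \<gamma>"
      using isometric_multiplier_schwarz_pick[OF iso \<psi>1] g(2) s unfolding s_def by (intro mult_mono) auto
    finally have c: "(cmod c)\<^sup>2 \<le> (s * \<gamma>)\<^sup>2" by (intro power_mono) auto
    have "mult_op fst (x n) - y = scaleC c (tensor ?\<psi> (h n))"
      unfolding x_def y_def mult_fst_tensor[OF eH hH] tensor_diff_scale_left[OF hardy_disc_shift[OF eH] \<psi>H hH] by simp
    then have "(norm (mult_op fst (x n) - y))\<^sup>2 = (cmod c)\<^sup>2 * (1 / s)"
      by (simp only: norm_scaleC power_mult_distrib norm_tensor_sq[OF \<psi>H hH] isometric_multiplier_sqnorm[OF iso] hs mult_1)
    also have "\<dots> \<le> (s * \<gamma>)\<^sup>2 * (1 / s)" using c s by (intro mult_right_mono) auto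
    also have "\<dots> = s * \<gamma>\<^sup>2" using s by (simp add: power2_eq_square)
    finally have 1: "(norm (mult_op fst (x n) - y))\<^sup>2 \<le> s * \<gamma>\<^sup>2" .
    \<comment> \<open>The backward shift removes from \<open>e\<close> its value \<open>s\<close> at
      the origin, which accounts for the loss of \<open>s\<^sup>2\<close>.\<close>
    have "(norm (backward_shift_fst (x n)))\<^sup>2 = (s - s\<^sup>2) * (1 / s)"
      using s by (simp add: x_def backward_shift_fst_tensor eH hH norm_tensor_sq hardy_disc_backward_shift
          hardy_disc_sqnorm_backward_shift es hs e0)
    also have "\<dots> = 1 - s" using s by (simp add: field_simps power2_eq_square)
    \<comment> \<open>The three contributions add up to
      \<open>(1 - s) - 1 + s * \<gamma>\<^sup>2\<close>.\<close>
    finally show ?thesis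
      using inner_self_commutator_fst_le[OF Q inv xQ[of n] y] 1 x2[of n] by (simp add: algebra_simps)
  qed
  moreover have "norm (x n) = 1" for n
    using x2[of n] norm_ge_zero[of "x n"] by (simp add: power2_eq_1_iff)
  \<comment> \<open>All orthogonality comes from the second factor, the first being the same for
    every index.\<close>
  moreover have "inner (x m) (x n) = 0" if "m < n" for m n
    using ho[OF that] by (subst inner_commute) (simp add: inner_hardy2_def x_def cinner_tensor eH hH)
  moreover have "0 < s * (1 - \<gamma>\<^sup>2)" using s \<gamma> by (simp add: power_less_one_iff)
  ultimately show False using not_compact_operator_on[of x ?Q "self_commutator_fst ?Q"] xQ compact by blast
qed

end
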